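(* Let $n,m\ge1$ be integers and let $\Psi:(\mathbb{Z}^m\times\mathbb{Z}^n)\setminus\{\mathbf{0}\}\to\mathbb{R}^+$ satisfy $$\lim_{|\mathbf{q}|\to\infty}\ \sup_{\mathbf{p}\in\mathbb{Z}^m}\frac{\Psi(\mathbf{p},\mathbf{q})}{|\mathbf{q}|}=0.$$ Let $\mathbf{y}\in\mathbb{I}^m$ and $\Phi\in\mathbb{I}^{mm}\setminus\{\mathbf{0}\}$ be fixed. Let $f$ and $g:r\mapsto g(r):=r^{-m(n-1)}f(r)$ be dimension functions such that $r^{-nm}f(r)$ is monotonic. Define $\Theta(\mathbf{p},\mathbf{q})=|\mathbf{q}|\,g\!\left(\frac{\Psi(\mathbf{p},\mathbf{q})}{|\mathbf{q}|}\right)^{1/m}$. If $|\mathcal{M}^{\mathbf{y},\Phi}_{n,m}(\Theta)|=1$, then $\mathcal{H}^f(\mathcal{M}^{\mathbf{y},\Phi}_{n,m}(\Psi))=\mathcal{H}^f(\mathbb{I}^{nm})$.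
   Context: $\mathbb{I}^d=[0,1]^d$; $\mathbb{I}^{mm}$ is regarded as the set of real $m\times m$ matrices with entries in $[0,1]$; $|X|$ denotes Lebesgue measure. Points $\mathbf{x}\in\mathbb{I}^{nm}$ are real $n\times m$ matrices; $\mathbf{q}\in\mathbb{Z}^n$ and $\mathbf{p}\in\mathbb{Z}^m$ are row vectors; $|\cdot|$ is the supremum norm. For $\Xi:(\mathbb{Z}^m\times\mathbb{Z}^n)\setminus\{\mathbf{0}\}\to\mathbb{R}^+$, $\mathcal{M}^{\mathbf{y},\Phi}_{n,m}(\Xi)$ is the set of $\mathbf{x}\in\mathbb{I}^{nm}$ such that $|\mathbf{q}\mathbf{x}+\mathbf{p}\Phi-\mathbf{y}|<\Xi(\mathbf{p},\mathbf{q})$ holds for $(\mathbf{p},\mathbf{q})\in(\mathbb{Z}^m\times\mathbb{Z}^n)\setminus\{\mathbf{0}\}$ with arbitrarily large $|\mathbf{q}|$. A dimension function is a left continuous, non-decreasing $f:\mathbb{R}^+\to\mathbb{R}^+$ with $f(r)\to0$ as $r\to0$; $\mathcal{H}^f$ is Hausdorff $f$-measure. *)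

theory Defs
  imports "HOL-Analysis.Analysis"
begin

text \<open>For vectors and matrices \<^term>\<open>One\<close> is the all-ones element, so this is the set of
  those with all entries in $[0,1]$.\<close>

abbreviation unit_cube :: "'a::euclidean_space set"
  where "unit_cube \<equiv> cbox 0 One"

definition real_vec :: "int^'k \<Rightarrow> real^'k"
  where "real_vec v = (\<chi> i. real_of_int (v $ i))"

abbreviation height :: "int^'k \<Rightarrow> real"
  where "height v \<equiv> infnorm (real_vec v)"

text \<open>The filter \<open>|q| \<rightarrow> \<infinity>\<close> on integer vectors, for the supremum norm.\<close>

definition height_at_top :: "(int^'k) filter"
  where "height_at_top = filtercomap height at_top"

text \<open>Points of \<^typ>\<open>real^'m^'n\<close> are matrices with \<open>CARD('n)\<close> rows and \<open>CARD('m)\<close> columns.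
  The value of \<open>\<Xi>\<close> at \<open>(0, 0)\<close> is never used.\<close>

definition approximable_set ::
    "real^'m \<Rightarrow> real^'m^'m \<Rightarrow> ((int^'m) \<times> (int^'n) \<Rightarrow> real) \<Rightarrow> (real^'m^'n) set"
  where "approximable_set y \<Phi> \<Xi> =
    {x \<in> unit_cube. \<forall>N::real. \<exists>p q. (p, q) \<noteq> 0 \<and> height q \<ge> N \<and>
       infnorm (real_vec q v* x + real_vec p v* \<Phi> - y) < \<Xi> (p, q)}"

text \<open>Only the values on $[0,\infty)$ matter. Note that \<open>f 0 = 0\<close> follows from
  monotonicity, nonnegativity and the limit at 0.\<close>

definition dimension_function :: "(real \<Rightarrow> real) \<Rightarrow> bool"
  where "dimension_function f \<longleftrightarrow>
    (\<forall>r\<ge>0. 0 \<le> f r) \<and> mono_on {0..} f \<and>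
    (\<forall>r>0. continuous (at_left r) f) \<and> (f \<longlongrightarrow> 0) (at_right 0)"

text \<open>Covers are indexed by \<open>nat\<close>; a finite cover is padded with empty sets, which
  contribute \<open>f 0 = 0\<close>. Boundedness is required because \<^term>\<open>diameter\<close> is real-valued and
  unspecified on unbounded sets.\<close>

definition hausdorff_pre ::
    "(real \<Rightarrow> real) \<Rightarrow> real \<Rightarrow> 'a::metric_space set \<Rightarrow> ennreal"
  where "hausdorff_pre f \<rho> X =
    (INF U \<in> {U :: nat \<Rightarrow> 'a set. (\<forall>i. bounded (U i) \<and> diameter (U i) \<le> \<rho>) \<and> X \<subseteq> (\<Union>i. U i)}.
       \<Sum>i. ennreal (f (diameter (U i))))"

text \<open>The limit as \<open>\<rho> \<rightarrow> 0\<close> is a supremum, since \<^const>\<open>hausdorff_pre\<close> is antitone in \<open>\<rho>\<close>.\<close>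

definition hausdorff_measure :: "(real \<Rightarrow> real) \<Rightarrow> 'a::metric_space set \<Rightarrow> ennreal"
  where "hausdorff_measure f X = (SUP \<rho> \<in> {0<..}. hausdorff_pre f \<rho> X)"

end

theory Submission
  imports Defs
begin

text \<open>If \<open>f r / r\<^sup>n\<^sup>m\<close> is bounded near 0, then \<open>\<Theta>\<close> is at most a constant multiple of
  \<open>\<Psi>\<close>. Rescaling the slabs of a limsup set does not change its measure, so almost every point of the cube
  is \<open>\<Psi>\<close>-approximable, and \<open>H\<^sup>f\<close> vanishes on null sets.

  Otherwise \<open>f r / r\<^sup>n\<^sup>m\<close> increases to infinity as \<open>r\<close> tends to 0, and
  repeated redistribution of mass shows that the set has infinite \<open>H\<^sup>f\<close>-measure. Start from a multiple of
  Lebesgue measure that gives a ball of radius \<open>r\<close> mass at most \<open>f r\<close> for \<open>r \<le> \<rho>\<close>. Given an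
  absolutely continuous measure with density at most \<open>H\<close>, cover almost all of its support by disjoint balls of radius
  \<open>\<kappa>\<theta>\<close> centred on planes, where \<open>\<theta>\<close> is the half-width of the \<open>\<Theta>\<close>-slab, and in
  each of them push the mass onto a grid of small balls inside the \<open>\<Psi>\<close>-slab. The relation
  \<open>\<theta>\<^sup>m \<psi>\<^sup>l = f \<psi>\<close> with \<open>l = m (n - 1)\<close> yields mass at most a constant times
  \<open>H \<kappa>\<^sup>m f r\<close> at the new small scales, and rescaling invariance allows \<open>\<kappa>\<close> so small that
  this does not depend on \<open>H\<close>. Iterating, the intersection of the nested supports consists of
  \<open>\<Psi>\<close>-approximable points, and by compactness its \<open>H\<^sup>f\<close>-content at scale \<open>\<rho>\<close> is at
  least a constant times \<open>f \<rho> / \<rho>\<^sup>n\<^sup>m\<close>.\<close>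

section \<open>Hausdorff measures and fine covers\<close>

text \<open>The cover is carried over to \<open>nat\<close> by an enumeration of its index set.
  Numbers outside the image receive the empty set, whose diameter 0 costs
  \<open>f 0 = 0\<close>.\<close>

lemma hausdorff_pre_le_countable:
  assumes "countable C" "\<And>i. i \<in> C \<Longrightarrow> bounded (V i)" "\<And>i. i \<in> C \<Longrightarrow> diameter (V i) \<le> \<rho>"
    and "X \<subseteq> (\<Union>i\<in>C. V i)" "f 0 = 0" "\<rho> \<ge> 0"
  shows "hausdorff_pre f \<rho> X \<le> (\<integral>\<^sup>+i. ennreal (f (diameter (V i))) \<partial>count_space C)"
proof -
  let ?J = "to_nat_on C ` C"
  define W where "W n = (if n \<in> ?J then V (inv_into C (to_nat_on C) n) else {})" for n
  have inj: "inj_on (to_nat_on C) C"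
    using assms(1) by (rule inj_on_to_nat_on)
  have W: "W (to_nat_on C i) = V i" if "i \<in> C" for i
    using that inj by (simp add: W_def)
  have "hausdorff_pre f \<rho> X \<le> (\<Sum>n. ennreal (f (diameter (W n))))"
    unfolding hausdorff_pre_def
  proof (rule INF_lower, safe)
    fix n
    show "bounded (W n)"
      using assms(2) by (auto simp: W_def inv_into_into)
    show "diameter (W n) \<le> \<rho>"
      using assms(3,6) by (auto simp: W_def inv_into_into)
  next
    fix x assume "x \<in> X"
    then show "x \<in> (\<Union>n. W n)"
      using assms(4) W by blast
  qed
  also have "\<dots> = (\<integral>\<^sup>+n. ennreal (f (diameter (W n))) \<partial>count_space UNIV)"
    by (simp add: nn_integral_count_space_nat)
  also have "\<dots> = (\<integral>\<^sup>+n. ennreal (f (diameter (W n))) * indicator ?J n \<partial>count_space UNIV)"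
    by (rule nn_integral_cong) (auto simp: W_def indicator_def assms(5))
  also have "\<dots> = (\<integral>\<^sup>+n. ennreal (f (diameter (W n))) \<partial>count_space ?J)"
    by (subst nn_integral_count_space_indicator[of ?J]) auto
  also have "\<dots> = (\<integral>\<^sup>+i. ennreal (f (diameter (W (to_nat_on C i)))) \<partial>count_space C)"
    using inj by (intro nn_integral_bij_count_space[symmetric]) (simp add: bij_betw_def)
  also have "\<dots> = (\<integral>\<^sup>+i. ennreal (f (diameter (V i))) \<partial>count_space C)"
    by (rule nn_integral_cong) (simp add: W)
  finally show ?thesis .
qed

lemma hausdorff_pre_mono: "X \<subseteq> Y \<Longrightarrow> hausdorff_pre f \<rho> X \<le> hausdorff_pre f \<rho> Y"
  unfolding hausdorff_pre_def by (rule INF_superset_mono) auto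

lemma hausdorff_measure_mono: "X \<subseteq> Y \<Longrightarrow> hausdorff_measure f X \<le> hausdorff_measure f Y"
  unfolding hausdorff_measure_def by (rule SUP_mono) (use hausdorff_pre_mono in blast)

text \<open>A cover of \<open>X\<close> and a cover of \<open>Z\<close> of total cost below
  \<open>e\<close> merge into one cover indexed by \<open>bool \<times> nat\<close>, whose cost is
  the sum of the two.\<close>

lemma hausdorff_pre_Un_null:
  assumes "f 0 = 0" "\<rho> \<ge> 0" "hausdorff_pre f \<rho> Z = 0"
  shows "hausdorff_pre f \<rho> (X \<union> Z) \<le> hausdorff_pre f \<rho> X"
proof -
  let ?A = "\<lambda>X. {U :: nat \<Rightarrow> 'a set. (\<forall>i. bounded (U i) \<and> diameter (U i) \<le> \<rho>) \<and> X \<subseteq> (\<Union>i. U i)}"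
  let ?s = "\<lambda>U :: nat \<Rightarrow> 'a set. \<Sum>i. ennreal (f (diameter (U i)))"
  have main: "hausdorff_pre f \<rho> (X \<union> Z) \<le> ?s U + ?s W" if UW: "U \<in> ?A X" "W \<in> ?A Z" for U W
  proof -
    let ?V = "\<lambda>(b, i). if b then U i else W i"
    have "hausdorff_pre f \<rho> (X \<union> Z)
        \<le> (\<integral>\<^sup>+z. ennreal (f (diameter (?V z))) \<partial>count_space (UNIV :: (bool \<times> nat) set))"
    proof (rule hausdorff_pre_le_countable)
      show "X \<union> Z \<subseteq> (\<Union>z\<in>UNIV. ?V z)"
      proof
        fix x assume "x \<in> X \<union> Z"
        then obtain i where "x \<in> U i \<or> x \<in> W i"
          using UW by blast
        then have "x \<in> ?V (True, i) \<or> x \<in> ?V (False, i)"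
          by simp
        then show "x \<in> (\<Union>z\<in>UNIV. ?V z)"
          by blast
      qed
    qed (use UW assms in \<open>auto split: if_splits\<close>)
    also have "\<dots> = (\<integral>\<^sup>+b. \<integral>\<^sup>+i. ennreal (f (diameter (?V (b, i)))) \<partial>count_space UNIV \<partial>count_space UNIV)"
      by (rule nn_integral_fst_count_space[symmetric])
    also have "\<dots> = ?s U + ?s W"
      by (simp add: nn_integral_count_space_finite UNIV_bool nn_integral_count_space_nat add.commute)
    finally show ?thesis .
  qed
  have "hausdorff_pre f \<rho> (X \<union> Z) \<le> ?s U" if "U \<in> ?A X" for U
  proof (rule ennreal_le_epsilon)
    fix e :: real assume "e > 0"
    then have "(INF W\<in>?A Z. ?s W) < ennreal e"
      using assms(3) by (simp add: hausdorff_pre_def)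
    then obtain W where W: "W \<in> ?A Z" "?s W < ennreal e"
      unfolding INF_less_iff by blast
    show "hausdorff_pre f \<rho> (X \<union> Z) \<le> ?s U + ennreal e"
      using main[OF that W(1)] W(2) by (meson add_left_mono less_imp_le order_trans)
  qed
  then show ?thesis
    unfolding hausdorff_pre_def[of f \<rho> X] by (rule INF_greatest)
qed

lemma hausdorff_measure_Un_null:
  assumes "f 0 = 0" "\<And>\<rho>. \<rho> > 0 \<Longrightarrow> hausdorff_pre f \<rho> Z = 0"
  shows "hausdorff_measure f (X \<union> Z) = hausdorff_measure f X"
proof (rule antisym)
  show "hausdorff_measure f (X \<union> Z) \<le> hausdorff_measure f X"
    unfolding hausdorff_measure_def
  proof (rule SUP_mono)
    fix \<rho> :: real assume "\<rho> \<in> {0<..}"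
    then show "\<exists>\<rho>'\<in>{0<..}. hausdorff_pre f \<rho> (X \<union> Z) \<le> hausdorff_pre f \<rho>' X"
      using assms by (intro bexI[of _ \<rho>] hausdorff_pre_Un_null) auto
  qed
qed (rule hausdorff_measure_mono, simp)

text \<open>Enclose \<open>Z\<close> in an open set \<open>U\<close> of measure at most
  \<open>e\<close>. The covering lemma gives disjoint balls inside \<open>U\<close> whose fivefold
  enlargements cover \<open>Z\<close>, and each enlargement costs at most \<open>K'\<close> times
  the volume of its ball.\<close>

lemma hausdorff_pre_negligible:
  fixes Z :: "'a::euclidean_space set"
  assumes Z: "negligible Z" and \<rho>: "\<rho> > 0" and f0: "f 0 = 0" and r0: "r0 > 0"
    and f: "\<And>r. 0 < r \<Longrightarrow> r \<le> r0 \<Longrightarrow> f r \<le> K * r ^ DIM('a)"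
  shows "hausdorff_pre f \<rho> Z = 0"
proof -
  let ?k = "DIM('a)"
  let ?v = "unit_ball_vol (real ?k)"
  \<comment> \<open>Chosen so that \<open>max K 0 * (10 * s) ^ DIM('a)\<close> is \<open>K'\<close>
    times the volume of a ball of radius \<open>s\<close>; the maximum keeps it nonnegative, as
    calculations in \<open>ennreal\<close> require.\<close>
  define K' where "K' = max K 0 * 10 ^ ?k / ?v"
  have v: "?v > 0" by simp
  have K'0: "K' \<ge> 0" using v by (simp add: K'_def)
  have "hausdorff_pre f \<rho> Z \<le> ennreal (K' * e)" if e: "e > 0" for e
  proof -
    have "Z \<in> sets lebesgue"
      using Z by (simp add: negligible_imp_sets)
    then obtain U where U: "open U" "Z \<subseteq> U" "emeasure lebesgue (U - Z) < ennreal e"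
      using sets_lebesgue_outer_open[OF _ e] by metis
    have "emeasure lebesgue U = emeasure lebesgue (U - Z)"
      using Z by (intro emeasure_Diff_null_set[symmetric]) (use U in \<open>auto simp: negligible_iff_null_sets\<close>)
    then have Ue: "emeasure lborel U \<le> ennreal e"
      using U by simp
    \<comment> \<open>The enlarged balls have diameter \<open>10 * s i\<close>, which must exceed
      neither \<open>r0\<close> nor \<open>\<rho>\<close>.\<close>
    define r1 where "r1 = min r0 \<rho> / 10"
    have r1: "r1 > 0" using r0 \<rho> by (simp add: r1_def)
    have "\<exists>s. 0 < s \<and> s \<le> r1 \<and> cball x s \<subseteq> U" if "x \<in> Z" for x
    proof -
      obtain s where "s > 0" "cball x s \<subseteq> U"
        using U(1,2) \<open>x \<in> Z\<close> open_contains_cball by blast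
      then show ?thesis
        using r1 by (intro exI[of _ "min s r1"]) auto
    qed
    then obtain s where s: "\<And>x. x \<in> Z \<Longrightarrow> 0 < s x" "\<And>x. x \<in> Z \<Longrightarrow> s x \<le> r1"
        "\<And>x. x \<in> Z \<Longrightarrow> cball x (s x) \<subseteq> U"
      by metis
    have cov: "Z \<subseteq> (\<Union>i\<in>Z. cball i (s i))"
    proof
      fix x assume "x \<in> Z"
      then show "x \<in> (\<Union>i\<in>Z. cball i (s i))"
        using s(1)[of x] by (intro UN_I[of x]) auto
    qed
    obtain C where C: "countable C" "C \<subseteq> Z"
        "pairwise (\<lambda>i j. disjnt (cball i (s i)) (cball j (s j))) C"
        "Z \<subseteq> (\<Union>i\<in>C. cball i (5 * s i))"
      by (rule Vitali_covering_lemma_cballs[OF cov, of r1]) (use s in auto)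
    have "hausdorff_pre f \<rho> Z \<le> (\<integral>\<^sup>+i. ennreal (f (diameter (cball i (5 * s i)))) \<partial>count_space C)"
    proof (rule hausdorff_pre_le_countable)
      fix i assume "i \<in> C"
      then have "0 < s i" "s i \<le> r1" using C(2) s by auto
      then show "diameter (cball i (5 * s i)) \<le> \<rho>"
        using r0 \<rho> by (simp add: diameter_cball r1_def)
    qed (use C f0 \<rho> in auto)
    also have "\<dots> \<le> (\<integral>\<^sup>+i. ennreal K' * emeasure lborel (cball i (s i)) \<partial>count_space C)"
    proof (rule nn_integral_mono)
      fix i assume "i \<in> space (count_space C)"
      then have i: "0 < s i" "s i \<le> r1" using C(2) s by auto
      have "f (diameter (cball i (5 * s i))) = f (10 * s i)"
        using i by (simp add: diameter_cball)
      also have "\<dots> \<le> K * (10 * s i) ^ ?k"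
        using i r0 \<rho> by (intro f) (auto simp: r1_def)
      also have "\<dots> \<le> max K 0 * (10 * s i) ^ ?k"
        using i by (intro mult_right_mono) auto
      also have "\<dots> = K' * (?v * s i ^ ?k)"
        using less_imp_neq[OF v] by (simp add: K'_def power_mult_distrib)
      finally have "ennreal (f (diameter (cball i (5 * s i)))) \<le> ennreal (K' * (?v * s i ^ ?k))"
        by (rule ennreal_leI)
      also have "\<dots> = ennreal K' * emeasure lborel (cball i (s i))"
        using i K'0 by (simp add: emeasure_cball ennreal_mult'')
      finally show "ennreal (f (diameter (cball i (5 * s i)))) \<le> \<dots>" .
    qed
    also have "\<dots> = ennreal K' * (\<integral>\<^sup>+i. emeasure lborel (cball i (s i)) \<partial>count_space C)"
      by (rule nn_integral_cmult) simp
    also have "(\<integral>\<^sup>+i. emeasure lborel (cball i (s i)) \<partial>count_space C)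
        = emeasure lborel (\<Union>i\<in>C. cball i (s i))"
      using C by (intro emeasure_UN_countable[symmetric])
        (auto simp: disjoint_family_on_def pairwise_def disjnt_def)
    also have "\<dots> \<le> emeasure lborel U"
      using C(2) s(3) U(1) by (intro emeasure_mono) auto
    also note Ue
    finally show ?thesis
      using K'0 e by (simp add: ennreal_mult mult_left_mono)
  qed
  then have "hausdorff_pre f \<rho> Z \<le> ennreal e" if "e > 0" for e
  proof -
    have "K' * (e / (K' + 1)) \<le> e" using that K'0 by (simp add: field_simps)
    then show ?thesis
      using \<open>\<And>e. e > 0 \<Longrightarrow> hausdorff_pre f \<rho> Z \<le> ennreal (K' * e)\<close>[of "e / (K' + 1)"] that K'0
      by (meson divide_pos_pos add_nonneg_pos zero_less_one ennreal_leI order_trans)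
  qed
  then show ?thesis
    using ennreal_le_epsilon[of 0 "hausdorff_pre f \<rho> Z"] by simp
qed

text \<open>Each ball of a fine cover contains the concentric ball with radius scaled by \<open>\<kappa>\<close>, so by Vitali
  a set missing all scaled balls can have no mass.\<close>

lemma negligible_fine_cover_scale:
  fixes a :: "'i \<Rightarrow> 'a::euclidean_space" and r :: "'i \<Rightarrow> real"
  assumes U: "U \<in> lmeasurable" and \<kappa>: "0 < \<kappa>" "\<kappa> \<le> 1"
    and neg: "negligible (U - {x. \<forall>d>0. \<exists>i\<in>I. 0 < r i \<and> r i < d \<and> x \<in> cball (a i) (r i)})"
  shows "negligible (U - {x. \<forall>d>0. \<exists>i\<in>I. 0 < r i \<and> r i < d \<and> x \<in> cball (a i) (\<kappa> * r i)})"
proof -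
  let ?k = "DIM('a)"
  let ?S = "{x. \<forall>d>0. \<exists>i\<in>I. 0 < r i \<and> r i < d \<and> x \<in> cball (a i) (r i)}"
  \<comment> \<open>\<open>E d\<close> is a union of open balls, hence measurable whatever the size
    of \<open>I\<close>. It suffices that every \<open>U - E d\<close> is null, since countably many
    \<open>d\<close> exhaust the set in question.\<close>
  define E where "E d = (\<Union>i\<in>{i\<in>I. 0 < r i \<and> r i < d}. ball (a i) (\<kappa> * r i))" for d
  have "negligible (U - E d)" if d: "d > 0" for d
  proof -
    have X: "U - E d \<in> lmeasurable"
      by (intro fmeasurable_Diff U) (simp add: E_def open_UN)
    \<comment> \<open>Disjoint Vitali balls inside an open \<open>V\<close> cover
      \<open>U - E d\<close> up to a null set. Their shrunken copies lie in \<open>V\<close> and in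
      \<open>E d\<close>, hence in \<open>V - (U - E d)\<close>, which has measure below
      \<open>e\<close>; shrinking multiplies volumes by the fixed factor
      \<open>\<kappa> ^ DIM('a)\<close>.\<close>
    have "emeasure lebesgue (U - E d) \<le> ennreal (1 / \<kappa> ^ ?k) * ennreal e" if e: "e > 0" for e
    proof -
      obtain V where V: "open V" "U - E d \<subseteq> V" "emeasure lebesgue (V - (U - E d)) < ennreal e"
        using sets_lebesgue_outer_open[OF _ e, of "U - E d"] X by (metis fmeasurableD)
      define K where "K = {i\<in>I. 0 < r i \<and> r i < d \<and> cball (a i) (r i) \<subseteq> V}"
      have fine: "\<exists>i. i \<in> K \<and> x \<in> cball (a i) (r i) \<and> r i < t"
        if x: "x \<in> (U - E d) \<inter> ?S" and t: "0 < t" for x t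
      proof -
        obtain s where s: "s > 0" "ball x s \<subseteq> V"
          using x V(1,2) open_contains_ball by blast
        \<comment> \<open>A ball of radius below \<open>s / 2\<close> that contains \<open>x\<close>
          stays inside \<open>ball x s\<close>.\<close>
        define u where "u = min (min t d) (s/2)"
        have "u > 0" using s t d by (simp add: u_def)
        then obtain i where i: "i \<in> I" "0 < r i" "r i < u" "x \<in> cball (a i) (r i)"
          using x by blast
        have "cball (a i) (r i) \<subseteq> ball x s"
        proof
          fix z assume "z \<in> cball (a i) (r i)"
          then have "dist x z \<le> r i + r i"
            using i(4) dist_triangle3[of x z "a i"] by (simp add: dist_commute)
          then show "z \<in> ball x s"
            using i(3) by (simp add: u_def)
        qed
        then show ?thesis
          using i s by (auto simp: K_def u_def)
      qed
      obtain C where C: "countable C" "C \<subseteq> K"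
          "pairwise (\<lambda>i j. disjnt (cball (a i) (r i)) (cball (a j) (r j))) C"
          "negligible ((U - E d) \<inter> ?S - (\<Union>i\<in>C. cball (a i) (r i)))"
        using Vitali_covering_theorem_cballs[of K r "(U - E d) \<inter> ?S" a] fine by (auto simp: K_def)
      have sub: "ball (a i) (\<kappa> * r i) \<subseteq> cball (a i) (r i)" if "i \<in> C" for i
      proof -
        have "\<kappa> * r i \<le> 1 * r i"
          using that C(2) \<kappa> by (intro mult_right_mono) (auto simp: K_def)
        then show ?thesis by auto
      qed
      let ?Y = "\<Union>i\<in>C. cball (a i) (r i)"
      have Y: "?Y \<in> sets borel" using C(1) by auto
      have Y': "(\<Union>i\<in>C. ball (a i) (\<kappa> * r i)) \<in> sets borel"
        by (intro borel_open) auto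
      have null: "U - E d - ?Y \<in> null_sets lebesgue"
        unfolding negligible_iff_null_sets[symmetric]
        by (rule negligible_subset[OF negligible_Un[OF C(4) neg]]) auto
      have "emeasure lebesgue (U - E d) \<le> emeasure lebesgue (?Y \<union> (U - E d - ?Y))"
        using Y null by (intro emeasure_mono sets.Un) auto
      also have "\<dots> = emeasure lebesgue ?Y"
        using Y null by (intro emeasure_Un_null_set) auto
      also have "\<dots> = emeasure lborel ?Y"
        using Y by (subst emeasure_completion) auto
      also have "\<dots> = (\<integral>\<^sup>+i. emeasure lborel (cball (a i) (r i)) \<partial>count_space C)"
        using C by (intro emeasure_UN_countable)
          (auto simp: disjoint_family_on_def pairwise_def disjnt_def)
      also have "\<dots> = (\<integral>\<^sup>+i. ennreal (1 / \<kappa> ^ ?k) * emeasure lborel (ball (a i) (\<kappa> * r i)) \<partial>count_space C)"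
      proof (rule nn_integral_cong)
        fix i assume "i \<in> space (count_space C)"
        then have "r i > 0" using C(2) by (auto simp: K_def)
        then show "emeasure lborel (cball (a i) (r i))
            = ennreal (1 / \<kappa> ^ ?k) * emeasure lborel (ball (a i) (\<kappa> * r i))"
          using \<kappa> by (simp add: emeasure_cball emeasure_ball flip: ennreal_mult)
            (simp add: power_mult_distrib)
      qed
      also have "\<dots> = ennreal (1 / \<kappa> ^ ?k) * (\<integral>\<^sup>+i. emeasure lborel (ball (a i) (\<kappa> * r i)) \<partial>count_space C)"
        by (rule nn_integral_cmult) simp
      also have "(\<integral>\<^sup>+i. emeasure lborel (ball (a i) (\<kappa> * r i)) \<partial>count_space C)
          = emeasure lborel (\<Union>i\<in>C. ball (a i) (\<kappa> * r i))"
      proof (rule emeasure_UN_countable[symmetric])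
        show "disjoint_family_on (\<lambda>i. ball (a i) (\<kappa> * r i)) C"
          unfolding disjoint_family_on_def
        proof (intro ballI impI)
          fix i j assume ij: "i \<in> C" "j \<in> C" "i \<noteq> j"
          then have "cball (a i) (r i) \<inter> cball (a j) (r j) = {}"
            using C(3) by (auto simp: pairwise_def disjnt_def)
          then show "ball (a i) (\<kappa> * r i) \<inter> ball (a j) (\<kappa> * r j) = {}"
            using sub ij by blast
        qed
      qed (use C in auto)
      also have "\<dots> = emeasure lebesgue (\<Union>i\<in>C. ball (a i) (\<kappa> * r i))"
        using Y' by (subst emeasure_completion) auto
      also have "\<dots> \<le> emeasure lebesgue (V - (U - E d))"
      proof (rule emeasure_mono)
        show "(\<Union>i\<in>C. ball (a i) (\<kappa> * r i)) \<subseteq> V - (U - E d)"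
        proof (rule UN_least)
          fix i assume "i \<in> C"
          then have "i \<in> K" using C by auto
          then show "ball (a i) (\<kappa> * r i) \<subseteq> V - (U - E d)"
            using sub[OF \<open>i \<in> C\<close>] unfolding K_def E_def by auto
        qed
        show "V - (U - E d) \<in> sets lebesgue"
          using V(1) X by (intro sets.Diff[OF _ fmeasurableD]) auto
      qed
      also have "\<dots> \<le> ennreal e" using V(3) by simp
      finally show ?thesis by (simp add: mult_left_mono)
    qed
    then have "emeasure lebesgue (U - E d) \<le> ennreal e" if "e > 0" for e
      using \<open>\<And>e. e > 0 \<Longrightarrow> emeasure lebesgue (U - E d) \<le> ennreal (1 / \<kappa> ^ ?k) * ennreal e\<close>[of "e * \<kappa> ^ ?k"] that \<kappa>
      by (simp flip: ennreal_mult)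
    then have "emeasure lebesgue (U - E d) = 0"
      using ennreal_le_epsilon[of 0 "emeasure lebesgue (U - E d)"] by simp
    then show ?thesis
      using X by (auto simp: negligible_iff_null_sets null_sets_def)
  qed
  then have "negligible (\<Union>n. U - E (inverse (real (Suc n))))"
    by (intro negligible_countable_Union) auto
  then show ?thesis
  proof (rule negligible_subset)
    show "U - {x. \<forall>d>0. \<exists>i\<in>I. 0 < r i \<and> r i < d \<and> x \<in> cball (a i) (\<kappa> * r i)}
        \<subseteq> (\<Union>n. U - E (inverse (real (Suc n))))"
    proof
      fix x assume "x \<in> U - {x. \<forall>d>0. \<exists>i\<in>I. 0 < r i \<and> r i < d \<and> x \<in> cball (a i) (\<kappa> * r i)}"
      then obtain d where x: "x \<in> U" and d: "0 < d"
        and no: "\<not> (\<exists>i\<in>I. 0 < r i \<and> r i < d \<and> x \<in> cball (a i) (\<kappa> * r i))"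
        by blast
      obtain n where "inverse (real (Suc n)) < d"
        using reals_Archimedean[OF d] by blast
      then have "x \<notin> E (inverse (real (Suc n)))"
        using no unfolding E_def by fastforce
      then show "x \<in> (\<Union>n. U - E (inverse (real (Suc n))))"
        using x by blast
    qed
  qed
qed

section \<open>Affine planes of matrices\<close>

lemma infnorm_attained: "\<exists>i. \<bar>q $ i\<bar> = infnorm (q :: real^'n)"
proof -
  have "infnorm q \<in> (\<lambda>i. \<bar>q \<bullet> i\<bar>) ` Basis"
    unfolding infnorm_Max by (rule Max_in) auto
  then show ?thesis
    by (auto simp: Basis_vec_def inner_axis)
qed

lemma infnorm_leI_cart: "(\<And>i. \<bar>x $ i\<bar> \<le> b) \<Longrightarrow> infnorm (x :: real^'n) \<le> b"
  by (metis infnorm_attained)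

lemma vector_matrix_mult_nth: "(q v* x) $ j = (\<Sum>i\<in>UNIV. q $ i * x $ i $ j)"
  by (simp add: vector_matrix_mult_def)

lemma entry_le_norm: "\<bar>x $ i $ j\<bar> \<le> norm (x :: real^'m^'n)"
  by (meson Finite_Cartesian_Product.norm_nth_le component_le_norm_cart order_trans)

lemma norm_le_sum_entries:
  fixes x :: "real^'m^'n"
  shows "norm x \<le> (\<Sum>i\<in>UNIV. \<Sum>j\<in>UNIV. \<bar>x $ i $ j\<bar>)"
proof -
  have "norm x \<le> (\<Sum>i\<in>UNIV. norm (x $ i))"
    by (simp add: norm_vec_def L2_set_le_sum)
  also have "\<dots> \<le> (\<Sum>i\<in>UNIV. \<Sum>j\<in>UNIV. \<bar>x $ i $ j\<bar>)"
    by (intro sum_mono norm_le_l1_cart)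
  finally show ?thesis .
qed

lemma infnorm_vector_matrix_mult_le:
  fixes x :: "real^'m^'n"
  shows "infnorm (q v* x) \<le> real CARD('n) * infnorm q * norm x"
proof (rule infnorm_leI_cart)
  fix j
  have "\<bar>(q v* x) $ j\<bar> \<le> (\<Sum>i\<in>UNIV. \<bar>q $ i\<bar> * \<bar>x $ i $ j\<bar>)"
    unfolding vector_matrix_mult_nth by (rule order_trans[OF sum_abs]) (simp add: abs_mult)
  also have "\<dots> \<le> (\<Sum>i\<in>(UNIV::'n set). infnorm q * norm x)"
    by (intro sum_mono mult_mono component_le_infnorm_cart entry_le_norm) (auto simp: infnorm_pos_le)
  finally show "\<bar>(q v* x) $ j\<bar> \<le> real CARD('n) * infnorm q * norm x"
    by simp
qed

text \<open>Only the row where \<open>q\<close> attains its supremum norm is changed, by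
  \<open>w / q $ i0\<close> with \<open>w = q v* x + c\<close>. Dividing by the largest entry makes
  each of the \<open>CARD('m)\<close> changes at most \<open>infnorm w / infnorm q\<close>.\<close>

lemma near_affine_plane:
  fixes x :: "real^'m^'n"
  assumes "infnorm q > 0"
  obtains z where "q v* z + c = 0" "dist x z \<le> real CARD('m) * (infnorm (q v* x + c) / infnorm q)"
proof -
  obtain i0 where i0: "\<bar>q $ i0\<bar> = infnorm q"
    using infnorm_attained by blast
  then have q0: "q $ i0 \<noteq> 0" using assms by auto
  define w where "w = q v* x + c"
  define z where "z = (\<chi> i j. if i = i0 then x $ i $ j - w $ j / q $ i0 else x $ i $ j)"
  have "(q v* z + c) $ j = 0" for j
  proof -
    have "(q v* z) $ j = (\<Sum>i\<in>UNIV. q $ i * x $ i $ j - (if i = i0 then w $ j else 0))"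
      unfolding vector_matrix_mult_nth
      by (intro sum.cong) (use q0 in \<open>auto simp: z_def field_simps\<close>)
    also have "\<dots> = (q v* x) $ j - w $ j"
      by (simp add: sum_subtractf vector_matrix_mult_nth)
    finally show ?thesis by (simp add: w_def)
  qed
  then have "q v* z + c = 0" by (simp add: vec_eq_iff)
  moreover have "dist x z \<le> real CARD('m) * (infnorm w / infnorm q)"
  proof -
    have "dist x z \<le> (\<Sum>i\<in>UNIV. \<Sum>j\<in>UNIV. \<bar>(x - z) $ i $ j\<bar>)"
      unfolding dist_norm by (rule norm_le_sum_entries)
    also have "\<dots> = (\<Sum>i\<in>UNIV. if i = i0 then \<Sum>j\<in>UNIV. \<bar>w $ j / q $ i0\<bar> else 0)"
      by (intro sum.cong) (auto simp: z_def)
    also have "\<dots> = (\<Sum>j\<in>UNIV. \<bar>w $ j / q $ i0\<bar>)"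
      by simp
    also have "\<dots> \<le> (\<Sum>j\<in>(UNIV :: 'm set). infnorm w / infnorm q)"
      unfolding abs_divide i0
      by (intro sum_mono divide_right_mono component_le_infnorm_cart) (simp add: infnorm_pos_le)
    finally show ?thesis by simp
  qed
  ultimately show thesis using that w_def by blast
qed

text \<open>An interval of length \<open>2 * s / \<psi>\<close> holds at most
  \<open>2 * s / \<psi> + 1\<close> integers, and \<open>\<psi> \<le> s\<close> absorbs the
  1.\<close>

lemma card_int_affine_le:
  fixes \<psi> s \<alpha> :: real
  assumes "0 < \<psi>" "\<psi> \<le> s"
  shows "finite {t :: int. \<bar>\<alpha> + \<psi> * t\<bar> \<le> s}" "real (card {t :: int. \<bar>\<alpha> + \<psi> * t\<bar> \<le> s}) \<le> 3 * s / \<psi>"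
proof -
  let ?J = "{\<lceil>(- s - \<alpha>) / \<psi>\<rceil>..\<lfloor>(s - \<alpha>) / \<psi>\<rfloor>}"
  have sub: "{t :: int. \<bar>\<alpha> + \<psi> * t\<bar> \<le> s} \<subseteq> ?J"
    using assms by (auto simp: ceiling_le_iff le_floor_iff field_simps abs_le_iff)
  then show "finite {t :: int. \<bar>\<alpha> + \<psi> * t\<bar> \<le> s}"
    by (rule finite_subset) simp
  have "real (card {t :: int. \<bar>\<alpha> + \<psi> * t\<bar> \<le> s}) \<le> real (card ?J)"
    using card_mono[OF _ sub] by simp
  also have "\<dots> \<le> 2 * s / \<psi> + 1"
  proof -
    have "real_of_int (\<lfloor>(s - \<alpha>) / \<psi>\<rfloor> - \<lceil>(- s - \<alpha>) / \<psi>\<rceil>) \<le> (s - \<alpha>) / \<psi> - (- s - \<alpha>) / \<psi>"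
      by linarith
    also have "\<dots> = 2 * s / \<psi>" using assms by (simp add: field_simps)
    finally show ?thesis
      using assms by (cases "\<lfloor>(s - \<alpha>) / \<psi>\<rfloor> + 1 \<ge> \<lceil>(- s - \<alpha>) / \<psi>\<rceil>") auto
  qed
  also have "\<dots> \<le> 3 * s / \<psi>" using assms by (simp add: field_simps)
  finally show "real (card {t :: int. \<bar>\<alpha> + \<psi> * t\<bar> \<le> s}) \<le> 3 * s / \<psi>" .
qed

text \<open>All rows of the matrix but one range over a grid of mesh \<open>\<psi>\<close>; the row at which \<open>q\<close> attains its
  supremum norm is then determined by the equation of the plane, with coefficients of modulus at most 1.\<close>

lemma affine_plane_grid:
  fixes z :: "real^'m^'n"
  assumes q: "infnorm q > 0" and z: "q v* z + c = 0" and \<psi>: "0 < \<psi>" "\<psi> \<le> r"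
  defines "l \<equiv> (CARD('n) - 1) * CARD('m)"
    and "D \<equiv> real CARD('n) * real CARD('n) * real CARD('m)"
  shows "\<exists>P. finite P \<and> P \<subseteq> cball z r \<and> (\<forall>x\<in>P. q v* x + c = 0) \<and>
    (r / (D * \<psi>)) ^ l \<le> real (card P) \<and>
    (\<forall>a s. \<psi> \<le> s \<longrightarrow> real (card (P \<inter> cball a s)) \<le> (3 * s / \<psi>) ^ l)"
proof -
  obtain i0 where i0: "\<bar>q $ i0\<bar> = infnorm q"
    using infnorm_attained by blast
  then have q0: "q $ i0 \<noteq> 0" using q by auto
  have n1: "1 \<le> real CARD('n)"
    by (simp add: Suc_leI)
  have D: "D > 0" by (simp add: D_def)
  \<comment> \<open>Each of the \<open>CARD('n) * CARD('m)\<close> entries of \<open>w u\<close>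
    below will be at most \<open>CARD('n) * N\<close> in modulus, so the norm of \<open>w u\<close>
    is at most \<open>D * N\<close>. This \<open>N\<close> is the largest for which that bound keeps
    the grid within distance \<open>r\<close> of \<open>z\<close>; it may be 0.\<close>
  define N where "N = \<lfloor>r / (D * \<psi>)\<rfloor>"
  have N0: "N \<ge> 0" using D \<psi> by (simp add: N_def)
  have Nle: "N \<le> r / (D * \<psi>)" by (simp add: N_def)
  have N1: "r / (D * \<psi>) \<le> N + 1" unfolding N_def by linarith
  define IJ where "IJ = (- {i0}) \<times> (UNIV :: 'm set)"
  have fIJ: "finite IJ" and cIJ: "card IJ = l"
    by (simp_all add: IJ_def l_def card_cartesian_product Compl_eq_Diff_UNIV card_Diff_singleton)
  \<comment> \<open>Given the free rows, row \<open>i0\<close> is the only choice with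
    \<open>q v* w u = 0\<close>, so that \<open>w u\<close> is a direction of the plane.\<close>
  define w where "w u = (\<chi> i j. if i = i0 then - (\<Sum>i'\<in>-{i0}. q $ i' / q $ i0 * real_of_int (u (i', j)))
      else real_of_int (u (i, j)))" for u :: "'n \<times> 'm \<Rightarrow> int"
  define p where "p u = z + \<psi> *\<^sub>R w u" for u
  define G where "G = PiE IJ (\<lambda>_. {-N..N})"
  define P where "P = p ` G"
  have fG: "finite G" using fIJ by (auto simp: G_def intro: finite_PiE)
  have inj: "inj_on p (PiE IJ T)" for T
  proof (rule inj_onI, rule PiE_ext)
    fix u v ij assume uv: "p u = p v" "ij \<in> IJ"
    obtain i j where ij: "ij = (i, j)" "i \<noteq> i0" using uv(2) by (auto simp: IJ_def)
    have "p u $ i $ j = p v $ i $ j" using uv by simp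
    then show "u ij = v ij" using ij \<psi> by (simp add: p_def w_def)
  qed
  have qw: "(q v* w u) $ j = 0" for u j
  proof -
    have "(q v* w u) $ j = q $ i0 * w u $ i0 $ j + (\<Sum>i\<in>-{i0}. q $ i * w u $ i $ j)"
      unfolding vector_matrix_mult_nth Compl_eq_Diff_UNIV by (rule sum.remove) auto
    also have "(\<Sum>i\<in>-{i0}. q $ i * w u $ i $ j) = (\<Sum>i\<in>-{i0}. q $ i * real_of_int (u (i, j)))"
      by (intro sum.cong) (auto simp: w_def)
    also have "q $ i0 * w u $ i0 $ j = - (\<Sum>i\<in>-{i0}. q $ i * real_of_int (u (i, j)))"
      using q0 by (simp add: w_def sum_distrib_left)
    finally show ?thesis by simp
  qed
  have plane: "q v* x + c = 0" if x: "x \<in> P" for x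
  proof -
    obtain u where u: "x = p u" using x by (auto simp: P_def)
    have "(q v* x) $ j = (q v* z) $ j + \<psi> * (q v* w u) $ j" for j
      unfolding vector_matrix_mult_nth u p_def
      by (simp add: algebra_simps sum.distrib sum_distrib_left)
    then show ?thesis using z qw by (simp add: vec_eq_iff)
  qed
  have "P \<subseteq> cball z r"
  proof
    fix x assume "x \<in> P"
    then obtain u where u: "u \<in> G" "x = p u" by (auto simp: P_def)
    have uN: "\<bar>real_of_int (u (i, j))\<bar> \<le> N" if "i \<noteq> i0" for i j
    proof -
      have "u (i, j) \<in> {-N..N}"
        using PiE_mem[of u IJ "\<lambda>_. {-N..N}" "(i, j)"] u(1) that by (simp add: G_def IJ_def)
      then have "\<bar>u (i, j)\<bar> \<le> N" by auto
      then show ?thesis by (metis of_int_abs of_int_le_iff)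
    qed
    have "\<bar>w u $ i $ j\<bar> \<le> real CARD('n) * N" for i j
    proof (cases "i = i0")
      case True
      have "\<bar>w u $ i $ j\<bar> \<le> (\<Sum>i'\<in>-{i0}. \<bar>q $ i' / q $ i0 * real_of_int (u (i', j))\<bar>)"
        using True by (simp only: w_def vec_lambda_beta simp_thms if_True abs_minus_cancel sum_abs)
      also have "\<dots> \<le> (\<Sum>i'\<in>-{i0}. 1 * real_of_int N)"
        unfolding abs_mult abs_divide i0
        using q component_le_infnorm_cart[of q] uN N0 by (intro sum_mono mult_mono) auto
      also have "\<dots> \<le> real CARD('n) * N"
        using N0 by (auto intro!: mult_right_mono card_mono)
      finally show ?thesis .
    next
      case False
      then have "\<bar>w u $ i $ j\<bar> \<le> 1 * real_of_int N" using uN by (simp add: w_def)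
      also have "\<dots> \<le> real CARD('n) * N" using N0 n1 by (intro mult_right_mono) auto
      finally show ?thesis .
    qed
    then have "(\<Sum>i\<in>UNIV. \<Sum>j\<in>UNIV. \<bar>w u $ i $ j\<bar>) \<le> (\<Sum>i\<in>(UNIV::'n set). \<Sum>j\<in>(UNIV::'m set). real CARD('n) * N)"
      by (intro sum_mono)
    then have "norm (w u) \<le> D * real_of_int N"
      using norm_le_sum_entries[of "w u"] by (simp add: D_def mult_ac)
    also have "\<dots> \<le> D * (r / (D * \<psi>))"
      using Nle D by (intro mult_left_mono) auto
    finally have "\<psi> * norm (w u) \<le> \<psi> * (D * (r / (D * \<psi>)))"
      using \<psi> by (intro mult_left_mono) auto
    also have "\<dots> = r" using D \<psi> by simp
    finally show "x \<in> cball z r"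
      using \<psi> by (simp add: u p_def dist_norm)
  qed
  moreover have "(r / (D * \<psi>)) ^ l \<le> real (card P)"
  proof -
    have "card P = card G" unfolding P_def using inj by (simp add: card_image G_def)
    also have "\<dots> = nat (2 * N + 1) ^ l"
      using fIJ cIJ by (simp add: G_def card_PiE)
    finally have "real (card P) = (2 * real_of_int N + 1) ^ l" using N0 by simp
    \<comment> \<open>The floor loses less than 1, which the extra point of the symmetric range
      \<open>-N..N\<close> restores.\<close>
    moreover have "(r / (D * \<psi>)) ^ l \<le> (2 * real_of_int N + 1) ^ l"
      using N1 N0 D \<psi> by (intro power_mono) auto
    ultimately show ?thesis by simp
  qed
  moreover have "real (card (P \<inter> cball a s)) \<le> (3 * s / \<psi>) ^ l" if s: "\<psi> \<le> s" for a s
  proof -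
    \<comment> \<open>\<open>T ij\<close> holds the integers that put the entry \<open>ij\<close>
      within \<open>s\<close> of that of \<open>a\<close>. Since the free entries determine the
      point, the count in \<open>cball a s\<close> is at most the product of the
      cardinalities.\<close>
    define T where "T ij = {t :: int. \<bar>(z $ fst ij $ snd ij - a $ fst ij $ snd ij) + \<psi> * t\<bar> \<le> s}" for ij
    have T: "finite (T ij)" "real (card (T ij)) \<le> 3 * s / \<psi>" for ij
      unfolding T_def using card_int_affine_le[OF \<psi>(1) s] by auto
    have "P \<inter> cball a s \<subseteq> p ` PiE IJ T"
    proof
      fix x assume "x \<in> P \<inter> cball a s"
      then obtain u where u: "u \<in> G" "x = p u" and x: "norm (x - a) \<le> s"
        by (auto simp: P_def dist_norm norm_minus_commute)
      have "u (i, j) \<in> T (i, j)" if "i \<noteq> i0" for i j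
      proof -
        have "\<bar>(x - a) $ i $ j\<bar> \<le> s" using entry_le_norm[of "x - a" i j] x by simp
        then show ?thesis using that by (simp add: T_def u p_def w_def algebra_simps)
      qed
      then have "u \<in> PiE IJ T"
        using u(1) by (auto simp: G_def IJ_def PiE_iff)
      then show "x \<in> p ` PiE IJ T" using u(2) by blast
    qed
    then have "card (P \<inter> cball a s) \<le> card (p ` PiE IJ T)"
      using fIJ T(1) by (intro card_mono finite_imageI finite_PiE)
    also have "\<dots> = (\<Prod>ij\<in>IJ. card (T ij))"
      using inj fIJ by (simp add: card_image card_PiE)
    finally have "real (card (P \<inter> cball a s)) \<le> (\<Prod>ij\<in>IJ. real (card (T ij)))"
      by (metis of_nat_mono of_nat_prod)
    also have "\<dots> \<le> (\<Prod>ij\<in>IJ. 3 * s / \<psi>)"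
      using T(2) by (intro prod_mono) auto
    finally show ?thesis by (simp add: cIJ)
  qed
  moreover have "finite P"
    using fG by (simp add: P_def)
  ultimately show ?thesis
    using plane by (intro exI[of _ P] conjI ballI allI impI)
qed

section \<open>Mass transference\<close>

text \<open>Each of the balls contains a ball of radius \<open>r\<close> inside
  \<open>cball b (3 * r)\<close>. These are disjoint, so comparing volumes bounds their
  number.\<close>

lemma card_disjoint_cballs_le:
  fixes a :: "'i \<Rightarrow> 'a::euclidean_space"
  assumes "finite I" "r > 0" "\<And>i. i \<in> I \<Longrightarrow> r \<le> R i" "\<And>i. i \<in> I \<Longrightarrow> cball (a i) (R i) \<inter> cball b r \<noteq> {}"
    and disj: "pairwise (\<lambda>i j. disjnt (cball (a i) (R i)) (cball (a j) (R j))) I"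
  shows "real (card I) \<le> 3 ^ DIM('a)"
proof -
  let ?V = "unit_ball_vol (real DIM('a))"
  have "\<exists>c. cball c r \<subseteq> cball (a i) (R i) \<inter> cball b (3 * r)" if i: "i \<in> I" for i
  proof -
    obtain x where x: "dist (a i) x \<le> R i" "dist b x \<le> r"
      using assms(4)[OF i] by auto
    have R: "0 < R i" "r \<le> R i" using assms(2) assms(3)[OF i] by auto
    \<comment> \<open>Moving from the common point \<open>x\<close> the fraction
      \<open>r / R i\<close> of the way to the centre \<open>a i\<close> ends within
      \<open>R i - r\<close> of \<open>a i\<close> and within \<open>r\<close> of
      \<open>x\<close>.\<close>
    define c where "c = x + (r / R i) *\<^sub>R (a i - x)"
    have "dist (a i) c = norm ((1 - r / R i) *\<^sub>R (a i - x))"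
      by (simp add: c_def dist_norm algebra_simps)
    also have "\<dots> = (1 - r / R i) * dist (a i) x"
      using R by (simp add: dist_norm)
    also have "\<dots> \<le> (1 - r / R i) * R i"
      using R x by (intro mult_left_mono) auto
    also have "\<dots> = R i - r"
      using R by (simp add: left_diff_distrib)
    finally have 1: "dist (a i) c \<le> R i - r" .
    have "dist x c = (r / R i) * dist (a i) x"
      using R assms(2) by (simp add: c_def dist_norm)
    also have "\<dots> \<le> (r / R i) * R i"
      using R x assms(2) by (intro mult_left_mono) auto
    finally have 2: "dist x c \<le> r" using R by simp
    have "cball c r \<subseteq> cball (a i) (R i)" "cball c r \<subseteq> cball b (3 * r)"
      using 1 2 x(2) dist_triangle[of b c x] by (auto simp: cball_subset_cball_iff dist_commute)
    then show ?thesis by blast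
  qed
  then obtain c where c: "\<And>i. i \<in> I \<Longrightarrow> cball (c i) r \<subseteq> cball (a i) (R i)"
      "\<And>i. i \<in> I \<Longrightarrow> cball (c i) r \<subseteq> cball b (3 * r)"
    by (metis le_inf_iff)
  have "real (card I) * (?V * r ^ DIM('a)) = (\<Sum>i\<in>I. measure lborel (cball (c i) r))"
    using assms(2) by (simp add: content_cball)
  also have "\<dots> = measure lborel (\<Union>i\<in>I. cball (c i) r)"
  proof (rule measure_finite_Union[symmetric])
    show "disjoint_family_on (\<lambda>i. cball (c i) r) I"
      using disj c(1) by (fastforce simp: disjoint_family_on_def pairwise_def disjnt_def)
  qed (use assms in \<open>auto simp: emeasure_cball\<close>)
  also have "\<dots> \<le> measure lborel (cball b (3 * r))"
  proof (rule measure_mono_fmeasurable)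
    show "(\<Union>i\<in>I. cball (c i) r) \<subseteq> cball b (3 * r)" using c(2) by blast
    show "cball b (3 * r) \<in> fmeasurable lborel"
      using assms(2) by (simp add: fmeasurable_def emeasure_cball)
    show "(\<Union>i\<in>I. cball (c i) r) \<in> sets lborel"
      using assms(1) by auto
  qed
  also have "\<dots> = 3 ^ DIM('a) * (?V * r ^ DIM('a))"
    using assms(2) by (simp add: content_cball power_mult_distrib)
  finally show ?thesis
    using assms(2) by simp
qed

text \<open>All measures of the construction have this form. Bounded sets have finite volume, so
  masses can be computed with real-valued \<open>measure\<close>.\<close>

lemma emeasure_density_indicators:
  fixes B :: "'j \<Rightarrow> 'a::euclidean_space set"
  assumes "finite J" "\<And>j. j \<in> J \<Longrightarrow> 0 \<le> c j" "\<And>j. j \<in> J \<Longrightarrow> B j \<in> sets borel" "\<And>j. j \<in> J \<Longrightarrow> bounded (B j)"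
    and A: "A \<in> sets borel"
  shows "emeasure (density lborel (\<lambda>x. \<Sum>j\<in>J. ennreal (c j) * indicator (B j) x)) A
    = ennreal (\<Sum>j\<in>J. c j * measure lborel (A \<inter> B j))"
proof -
  have fin: "emeasure lborel (A \<inter> B j) = ennreal (measure lborel (A \<inter> B j))" if "j \<in> J" for j
  proof (rule emeasure_eq_ennreal_measure)
    have "bounded (A \<inter> B j)" using assms(4)[OF that] by blast
    then show "emeasure lborel (A \<inter> B j) \<noteq> top"
      using emeasure_bounded_finite by fastforce
  qed
  have "emeasure (density lborel (\<lambda>x. \<Sum>j\<in>J. ennreal (c j) * indicator (B j) x)) A
      = (\<integral>\<^sup>+x. (\<Sum>j\<in>J. ennreal (c j) * indicator (B j) x) * indicator A x \<partial>lborel)"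
    using assms
    by (intro emeasure_density borel_measurable_sum borel_measurable_times_ennreal borel_measurable_indicator) auto
  also have "\<dots> = (\<integral>\<^sup>+x. (\<Sum>j\<in>J. ennreal (c j) * indicator (A \<inter> B j) x) \<partial>lborel)"
    by (intro nn_integral_cong) (auto simp: indicator_def)
  also have "\<dots> = (\<Sum>j\<in>J. \<integral>\<^sup>+x. ennreal (c j) * indicator (A \<inter> B j) x \<partial>lborel)"
    using assms by (intro nn_integral_sum) auto
  also have "\<dots> = (\<Sum>j\<in>J. ennreal (c j) * emeasure lborel (A \<inter> B j))"
    using assms by (intro sum.cong refl nn_integral_cmult_indicator) auto
  also have "\<dots> = (\<Sum>j\<in>J. ennreal (c j * measure lborel (A \<inter> B j)))"
    using assms(2) by (intro sum.cong) (auto simp: fin ennreal_mult)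
  also have "\<dots> = ennreal (\<Sum>j\<in>J. c j * measure lborel (A \<inter> B j))"
    using assms(2) by (intro sum_ennreal) auto
  finally show ?thesis .
qed

text \<open>\<open>T N\<close> collects pairs of a centre on some plane and the half-width of the slab around it, \<open>\<theta>\<close> is the
  half-width of the inflated slab, and \<open>grid\<close> says that the planes have dimension \<open>l\<close>.\<close>

locale mass_transference =
  fixes f \<theta> :: "real \<Rightarrow> real" and k l m :: nat and V D \<sigma> \<tau> :: real
    and T :: "nat \<Rightarrow> ('a::euclidean_space \<times> real) set" and E :: "nat \<Rightarrow> 'a set" and U0 :: "'a set"
  assumes k: "k = DIM('a)" and V: "V = unit_ball_vol (real k)" and dim: "l + m = k" "m > 0"
    and const_bds: "D > 0" "\<sigma> > 0" "0 < \<tau>" "\<tau> \<le> 1"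
    and f_pos: "\<And>r. 0 < r \<Longrightarrow> 0 < f r"
    and f_anti: "\<And>r s. 0 < r \<Longrightarrow> r \<le> s \<Longrightarrow> f s / s ^ k \<le> f r / r ^ k"
    and f_unbounded: "\<And>B. \<exists>r>0. B \<le> f r / r ^ k"
    and g_mono: "\<And>r s. 0 < r \<Longrightarrow> r \<le> s \<Longrightarrow> f r / r ^ l \<le> f s / s ^ l"
    and \<theta>: "\<And>\<psi>. 0 < \<psi> \<Longrightarrow> 0 < \<theta> \<psi>" "\<And>\<psi>. 0 < \<psi> \<Longrightarrow> \<theta> \<psi> ^ m * \<psi> ^ l = f \<psi>"
    and T_pos: "\<And>N a \<psi>. (a, \<psi>) \<in> T N \<Longrightarrow> 0 < \<psi>"
    and T_target: "\<And>N a \<psi>. (a, \<psi>) \<in> T N \<Longrightarrow> cball a (\<tau> * \<psi>) \<subseteq> E N"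
    and grid: "\<And>N a \<psi> r. (a, \<psi>) \<in> T N \<Longrightarrow> \<psi> \<le> r \<Longrightarrow>
      \<exists>P. finite P \<and> P \<subseteq> cball a r \<and> (\<forall>z\<in>P. (z, \<psi>) \<in> T N) \<and> (r / (D * \<psi>)) ^ l \<le> real (card P) \<and>
        (\<forall>b s. \<psi> \<le> s \<longrightarrow> real (card (P \<inter> cball b s)) \<le> (3 * s / \<psi>) ^ l)"
    and U0: "open U0" "bounded U0"
    and fine: "\<And>N \<epsilon>. \<epsilon> > 0 \<Longrightarrow> negligible (U0 - {x. \<forall>d>0. \<exists>i\<in>{i\<in>T N. snd i < \<epsilon>}.
      0 < \<sigma> * \<theta> (snd i) \<and> \<sigma> * \<theta> (snd i) < d \<and> x \<in> cball (fst i) (\<sigma> * \<theta> (snd i))})"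
begin

lemma V_pos: "V > 0" by (simp add: V)

lemma fine_scaled:
  assumes "\<epsilon> > 0" "0 < \<kappa>" "\<kappa> \<le> 1"
  shows "negligible (U0 - {x. \<forall>d>0. \<exists>i\<in>{i\<in>T N. snd i < \<epsilon>}.
      0 < \<sigma> * \<theta> (snd i) \<and> \<sigma> * \<theta> (snd i) < d \<and> x \<in> cball (fst i) (\<kappa> * (\<sigma> * \<theta> (snd i)))})"
  by (rule negligible_fine_cover_scale)
    (use U0 assms fine[OF assms(1)] in \<open>auto intro: lmeasurable_open\<close>)

text \<open>As \<open>f r / r ^ k\<close> is antitone, one large value at \<open>\<delta>\<close>
  forces large values at all smaller radii.\<close>

lemma f_ratio_large: "\<exists>\<delta>>0. \<forall>r. 0 < r \<and> r \<le> \<delta> \<longrightarrow> B * r ^ k \<le> f r"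
proof -
  obtain \<delta> where "\<delta> > 0" "B \<le> f \<delta> / \<delta> ^ k" using f_unbounded by blast
  moreover from this have "B * r ^ k \<le> f r" if "0 < r" "r \<le> \<delta>" for r
    using f_anti[OF that] that by (simp add: pos_le_divide_eq[symmetric])
  ultimately show ?thesis by blast
qed

section \<open>Redistribution of mass onto grids\<close>

text \<open>The factor \<open>6 ^ l\<close> comes from counting grid points near a ball,
  \<open>V * (2 * D) ^ l * \<sigma> ^ m\<close> from the mass given to each grid point, and
  \<open>\<tau> ^ k\<close> from the volume of the small balls.\<close>

definition grid_mass_const :: real where "grid_mass_const = 6 ^ l * V * (2 * D) ^ l * \<sigma> ^ m / \<tau> ^ k"

lemma grid_mass_const_pos: "grid_mass_const > 0" using const_bds V_pos by (simp add: grid_mass_const_def)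

text \<open>The mass \<open>w\<close> of a ball of radius \<open>R\<close> is shared evenly among
  small balls around the points of \<open>P\<close>. For \<open>r \<le> \<psi>\<close> at most
  \<open>6 ^ l\<close> of them meet \<open>cball b r\<close>, and \<open>f_anti\<close> compares
  \<open>f \<psi> / \<psi> ^ k\<close> with \<open>f r / r ^ k\<close>. For larger \<open>r\<close>
  at most \<open>(6 * r / \<psi>) ^ l\<close> meet it, and \<open>g_mono\<close> compares
  \<open>f \<psi> / \<psi> ^ l\<close> with \<open>f r / r ^ l\<close>.\<close>

lemma grid_mass_le:
  fixes P :: "'a set"
  assumes \<psi>: "0 < \<psi>" "2 * \<psi> \<le> R" and R: "R = \<kappa> * (\<sigma> * \<theta> \<psi>)" and \<kappa>: "\<kappa> > 0" and r: "0 < r"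
    and w: "0 \<le> w" "w \<le> H * (V * R ^ k)" and H: "H \<ge> 0"
    and P: "finite P" "(R / 2 / (D * \<psi>)) ^ l \<le> real (card P)"
      "\<And>b s. \<psi> \<le> s \<Longrightarrow> real (card (P \<inter> cball b s)) \<le> (3 * s / \<psi>) ^ l"
  shows "(\<Sum>z\<in>P. w / (real (card P) * (V * (\<tau> * \<psi>) ^ k)) * measure lborel (cball b r \<inter> ball z (\<tau> * \<psi>)))
    \<le> grid_mass_const * (H * \<kappa> ^ m) * f r" (is "?lhs \<le> _")
proof -
  note [simp] = const_bds less_imp_le[OF const_bds(1)] less_imp_le[OF const_bds(2)] less_imp_le[OF const_bds(3)] V_pos
    less_imp_neq[OF V_pos, symmetric] less_imp_neq[OF const_bds(3), symmetric] less_imp_le[OF V_pos]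
  define W where "W = H * V * (2 * D) ^ l * (\<kappa> * \<sigma>) ^ m"
  have W0: "W \<ge> 0" using H \<kappa> by (simp add: W_def)
  have R0: "R > 0" using \<psi> by linarith
  have cP: "0 < real (card P)"
  proof -
    have "0 < (R / 2 / (D * \<psi>)) ^ l" using R0 \<psi> by simp
    then show ?thesis using P(2) by linarith
  qed
  \<comment> \<open>The mass per grid point is of order
    \<open>H * R ^ k / (R / \<psi>) ^ l = H * R ^ m * \<psi> ^ l\<close>, and
    \<open>R = \<kappa> * (\<sigma> * \<theta> \<psi>)\<close> turns this into a multiple of
    \<open>\<theta> \<psi> ^ m * \<psi> ^ l = f \<psi>\<close>.\<close>
  have wP: "w / real (card P) \<le> W * f \<psi>"
  proof -
    have "w / real (card P) \<le> H * (V * R ^ k) / (R / 2 / (D * \<psi>)) ^ l"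
      using w H P(2) R0 \<psi> by (intro frac_le) auto
    also have "\<dots> = H * V * (2 * D) ^ l * (R ^ m * \<psi> ^ l)"
      using R0 \<psi> by (simp add: dim(1)[symmetric] power_add power_divide power_mult_distrib field_simps)
    also have "R ^ m * \<psi> ^ l = (\<kappa> * \<sigma>) ^ m * f \<psi>"
      unfolding R using \<theta>(2)[OF \<psi>(1)] by (simp add: power_mult_distrib)
    finally show ?thesis by (simp add: W_def mult_ac)
  qed
  define Q where "Q = {z\<in>P. cball b r \<inter> ball z (\<tau> * \<psi>) \<noteq> {}}"
  have Q: "Q \<subseteq> P \<inter> cball b (r + \<psi>)"
  proof
    fix z assume "z \<in> Q"
    then obtain x where "z \<in> P" "dist b x \<le> r" "dist z x < \<tau> * \<psi>" by (auto simp: Q_def)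
    moreover have "\<tau> * \<psi> \<le> 1 * \<psi>" using \<psi> by (intro mult_right_mono) auto
    ultimately show "z \<in> P \<inter> cball b (r + \<psi>)"
      using dist_triangle[of b z x] by (simp add: dist_commute)
  qed
  have nQ: "real (card Q) \<le> (3 * s / \<psi>) ^ l" if "r + \<psi> \<le> s" for s
  proof -
    have "card Q \<le> card (P \<inter> cball b s)"
      using Q that P(1) by (intro card_mono) auto
    then show ?thesis using P(3)[of s b] that r by linarith
  qed
  have vol: "V * (\<tau> * \<psi>) ^ k > 0" using \<psi> V_pos by simp
  have mle: "measure lborel (cball b r \<inter> ball z (\<tau> * \<psi>)) \<le> min (V * r ^ k) (V * (\<tau> * \<psi>) ^ k)" for z
  proof -
    have "measure lborel (cball b r \<inter> ball z (\<tau> * \<psi>)) \<le> measure lborel (cball b r)"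
      by (rule measure_mono_fmeasurable) (auto simp: fmeasurable_def emeasure_cball r less_imp_le)
    moreover have "measure lborel (cball b r \<inter> ball z (\<tau> * \<psi>)) \<le> measure lborel (ball z (\<tau> * \<psi>))"
      using \<psi> by (intro measure_mono_fmeasurable) (auto simp: fmeasurable_def emeasure_ball less_imp_le)
    moreover have "0 \<le> \<tau> * \<psi>" using mult_pos_pos[OF const_bds(3) \<psi>(1)] by (rule less_imp_le)
    ultimately show ?thesis using r by (simp add: content_cball content_ball k V)
  qed
  \<comment> \<open>The overlap with a small ball is bounded by either volume: that of
    \<open>cball b r\<close> is used when \<open>r \<le> \<psi>\<close>, that of the small ball
    otherwise.\<close>
  have main: "?lhs \<le> real (card Q) * (W * f \<psi>) * (t / (V * (\<tau> * \<psi>) ^ k))"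
    if t: "t = V * r ^ k \<or> t = V * (\<tau> * \<psi>) ^ k" for t
  proof -
    have t0: "t \<ge> 0" using t r \<psi> by auto
    have "?lhs = (\<Sum>z\<in>Q. w / (real (card P) * (V * (\<tau> * \<psi>) ^ k)) * measure lborel (cball b r \<inter> ball z (\<tau> * \<psi>)))"
      using P(1) by (intro sum.mono_neutral_right) (auto simp: Q_def)
    also have "\<dots> \<le> (\<Sum>z\<in>Q. w / (real (card P) * (V * (\<tau> * \<psi>) ^ k)) * t)"
      using w cP vol t mle by (intro sum_mono mult_left_mono) (auto intro: order_trans)
    also have "\<dots> = real (card Q) * (w / real (card P)) * (t / (V * (\<tau> * \<psi>) ^ k))"
      by simp
    also have "\<dots> \<le> real (card Q) * (W * f \<psi>) * (t / (V * (\<tau> * \<psi>) ^ k))"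
      using wP t0 vol by (intro mult_right_mono mult_left_mono) auto
    finally show ?thesis .
  qed
  have f\<psi>: "f \<psi> > 0" using f_pos \<psi> by simp
  have grid_mass_const: "grid_mass_const * (H * \<kappa> ^ m) = 6 ^ l * W / \<tau> ^ k"
    by (simp add: grid_mass_const_def W_def power_mult_distrib)
  show ?thesis
  proof (cases "r \<le> \<psi>")
    case True
    have "?lhs \<le> real (card Q) * (W * f \<psi>) * (V * r ^ k / (V * (\<tau> * \<psi>) ^ k))"
      by (rule main) simp
    also have "\<dots> \<le> 6 ^ l * (W * f \<psi>) * (V * r ^ k / (V * (\<tau> * \<psi>) ^ k))"
      using nQ[of "2 * \<psi>"] True \<psi> W0 f\<psi> r vol by (intro mult_right_mono) auto
    also have "\<dots> = 6 ^ l * W / \<tau> ^ k * (f \<psi> / \<psi> ^ k * r ^ k)"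
      using V_pos by (simp add: power_mult_distrib)
    also have "\<dots> \<le> 6 ^ l * W / \<tau> ^ k * (f r / r ^ k * r ^ k)"
      using f_anti[OF r True] W0 r by (intro mult_left_mono mult_right_mono) auto
    finally show ?thesis using r by (simp add: grid_mass_const)
  next
    case False
    have "?lhs \<le> real (card Q) * (W * f \<psi>) * (V * (\<tau> * \<psi>) ^ k / (V * (\<tau> * \<psi>) ^ k))"
      by (rule main) simp
    also have "\<dots> = real (card Q) * (W * f \<psi>)"
      unfolding divide_self[OF less_imp_neq[OF vol, symmetric]] by (rule mult_1_right)
    also have "\<dots> \<le> (3 * (2 * r) / \<psi>) ^ l * (W * f \<psi>)"
      using nQ[of "2 * r"] False W0 f\<psi> by (intro mult_right_mono) auto
    also have "\<dots> = 6 ^ l * W * (f \<psi> / \<psi> ^ l * r ^ l)"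
      by (simp add: power_divide power_mult_distrib)
    also have "\<dots> \<le> 6 ^ l * W * (f r / r ^ l * r ^ l)"
      using g_mono[of \<psi> r] \<psi> False W0 r by (intro mult_left_mono mult_right_mono) auto
    also have "\<dots> = 6 ^ l * W * f r / 1" using r by simp
    also have "\<dots> \<le> 6 ^ l * W * f r / \<tau> ^ k"
      using W0 f_pos[OF r] by (intro divide_left_mono) (auto intro: power_le_one)
    finally show ?thesis by (simp add: grid_mass_const)
  qed
qed

text \<open>For \<open>L = f \<rho> / \<rho>\<^sup>k\<close> this agrees with \<open>f\<close> up to \<open>\<rho>\<close> and continues it
  by a multiple of Lebesgue measure, so that large balls need no separate treatment.\<close>

definition gauge :: "real \<Rightarrow> real \<Rightarrow> real" where "gauge L r = max (f r) (L * r ^ k)"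

text \<open>Neither \<open>f r\<close> nor \<open>L * r ^ k\<close> grows faster than
  \<open>r ^ k\<close>, and the maximum inherits this.\<close>

lemma gauge_scale:
  assumes "0 < r" "r \<le> s"
  shows "gauge L s \<le> (s / r) ^ k * gauge L r"
proof -
  have "f s \<le> (s / r) ^ k * f r"
    using f_anti[OF assms] assms by (simp add: field_simps power_divide)
  moreover have "L * s ^ k = (s / r) ^ k * (L * r ^ k)"
    using assms by (simp add: power_divide)
  moreover have "(s / r) ^ k * f r \<le> (s / r) ^ k * gauge L r" "(s / r) ^ k * (L * r ^ k) \<le> (s / r) ^ k * gauge L r"
    using assms by (intro mult_left_mono; simp add: gauge_def)+
  ultimately have "f s \<le> (s / r) ^ k * gauge L r" "L * s ^ k \<le> (s / r) ^ k * gauge L r"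
    by linarith+
  then show ?thesis
    by (simp add: gauge_def[of L s])
qed

lemma gauge_pos: "0 < r \<Longrightarrow> 0 < gauge L r"
  using f_pos[of r] by (simp add: gauge_def)

text \<open>The mass bound on balls deteriorates slightly at every refinement; all its constants stay below 2.\<close>

definition admissible :: "real \<Rightarrow> real \<Rightarrow> 'a measure \<Rightarrow> 'a set \<Rightarrow> bool" where
  "admissible L m0 M U \<longleftrightarrow> finite_measure M \<and> sets M = sets borel \<and> open U \<and> U \<subseteq> U0 \<and>
    emeasure M (- U) = 0 \<and> m0 < measure M U \<and>
    (\<exists>H\<ge>0. \<forall>A\<in>sets borel. emeasure M A \<le> ennreal H * emeasure lborel A) \<and>
    (\<exists>C<2. \<forall>a r. 0 < r \<longrightarrow> measure M (cball a r) \<le> C * gauge L r)"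

text \<open>The new mass of \<open>cball b r\<close> is estimated in two ranges. For
  \<open>r \<le> \<delta>\<close>, the Vitali balls of radius at least \<open>r\<close> that meet it
  number at most \<open>3 ^ k\<close> and are handled by \<open>grid_mass_le\<close>, while the
  smaller ones lie in \<open>cball b (3 * r)\<close>, whose old mass is at most
  \<open>f r / 2\<close>. For \<open>r > \<delta>\<close>, mass has moved by at most the diameter of
  a Vitali ball, so the old bound for a slightly larger ball applies.\<close>

lemma admissible_refine:
  assumes admissible: "admissible L m0 M U" and m0: "m0 \<ge> 0"
  shows "\<exists>M' U'. admissible L m0 M' U' \<and> closure U' \<subseteq> U \<inter> E N"
proof -
  note [simp] = const_bds less_imp_le[OF const_bds(1)] less_imp_le[OF const_bds(2)] less_imp_le[OF const_bds(3)] V_pos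
    less_imp_neq[OF V_pos, symmetric] less_imp_neq[OF const_bds(3), symmetric] less_imp_le[OF V_pos]
  interpret M: finite_measure M using admissible by (simp add: admissible_def)
  have sM: "sets M = sets borel" and U: "open U" "U \<subseteq> U0" and MU: "m0 < measure M U"
    using admissible by (auto simp: admissible_def)
  obtain H where H: "H \<ge> 0" "\<And>A. A \<in> sets borel \<Longrightarrow> emeasure M A \<le> ennreal H * emeasure lborel A"
    using admissible by (auto simp: admissible_def)
  obtain C0 where C0: "C0 < 2" "\<And>a r. 0 < r \<Longrightarrow> measure M (cball a r) \<le> C0 * gauge L r"
    using admissible by (auto simp: admissible_def)
  define C where "C = max C0 0"
  have C: "0 \<le> C" "C < 2" "\<And>a r. 0 < r \<Longrightarrow> measure M (cball a r) \<le> C * gauge L r"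
  proof -
    fix a r assume r: "(0::real) < r"
    have "C0 * gauge L r \<le> C * gauge L r"
      using gauge_pos[OF r, of L] by (intro mult_right_mono) (auto simp: C_def)
    then show "measure M (cball a r) \<le> C * gauge L r" using C0(2)[OF r, of a] by linarith
  qed (use C0(1) in \<open>auto simp: C_def\<close>)
  have Mball: "measure M (cball a r) \<le> H * (V * r ^ k)" if "0 < r" for a r
  proof -
    have "ennreal (measure M (cball a r)) = emeasure M (cball a r)"
      by (simp add: M.emeasure_eq_measure)
    also have "\<dots> \<le> ennreal H * emeasure lborel (cball a r)" by (rule H) simp
    also have "\<dots> = ennreal (H * (V * r ^ k))"
      using that H(1) by (simp add: emeasure_cball k V ennreal_mult)
    finally show ?thesis using that H(1) by (subst (asm) ennreal_le_iff) auto
  qed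
  \<comment> \<open>At radii \<open>r\<close> up to \<open>\<delta>\<close> the old measure gives a
    ball of radius \<open>3 * r\<close> at most half of \<open>f r\<close>.\<close>
  obtain \<delta> where \<delta>: "\<delta> > 0" "\<And>r. 0 < r \<Longrightarrow> r \<le> \<delta> \<Longrightarrow> 2 * H * V * 3 ^ k * r ^ k \<le> f r"
    using f_ratio_large[of "2 * H * V * 3 ^ k"] by auto
  \<comment> \<open>Here \<open>\<kappa>\<close> is fitted to \<open>H\<close>: at most
    \<open>3 ^ k\<close> large Vitali balls together contribute at most half of \<open>f r\<close>.
    As \<open>m > 0\<close>, the factor \<open>\<kappa> ^ m\<close> is at most
    \<open>\<kappa>\<close> and can be made small.\<close>
  obtain \<kappa> where \<kappa>: "0 < \<kappa>" "\<kappa> \<le> 1" "3 ^ k * (grid_mass_const * (H * \<kappa> ^ m)) \<le> 1 / 2"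
  proof -
    define B where "B = 2 * (3 ^ k * (grid_mass_const * H))"
    have B: "B \<ge> 0" using grid_mass_const_pos H by (simp add: B_def)
    define \<kappa> where "\<kappa> = 1 / (B + 1)"
    have \<kappa>: "0 < \<kappa>" "\<kappa> \<le> 1" using B by (auto simp: \<kappa>_def)
    have "\<kappa> ^ m \<le> \<kappa> ^ 1" using \<kappa> dim(2) by (intro power_decreasing) auto
    then have "B * \<kappa> ^ m \<le> B * \<kappa>" using B by (intro mult_left_mono) auto
    also have "\<dots> \<le> 1" using B by (simp add: \<kappa>_def)
    finally show thesis using that[OF \<kappa>] by (simp add: B_def mult_ac)
  qed
  \<comment> \<open>For \<open>r > \<delta>\<close>, passing from \<open>r\<close> to
    \<open>r + 2 * \<eta>\<close> enlarges the gauge by at most the factor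
    \<open>(1 + 2 * \<eta> / \<delta>) ^ k\<close>, and \<open>C < 2\<close> leaves room for
    it.\<close>
  obtain \<eta> where \<eta>: "\<eta> > 0" "C * (1 + 2 * \<eta> / \<delta>) ^ k < 2"
  proof -
    have "((\<lambda>\<eta>. C * (1 + 2 * \<eta> / \<delta>) ^ k) \<longlongrightarrow> C * (1 + 2 * 0 / \<delta>) ^ k) (at_right 0)"
      by (intro tendsto_intros) (use \<delta> in auto)
    then have "eventually (\<lambda>\<eta>. C * (1 + 2 * \<eta> / \<delta>) ^ k < 2) (at_right 0)"
      using C(2) by (intro order_tendstoD(2)) auto
    then have "eventually (\<lambda>\<eta>. \<eta> > 0 \<and> C * (1 + 2 * \<eta> / \<delta>) ^ k < 2) (at_right 0)"
      using eventually_at_right_less[of 0] by eventually_elim simp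
    then show thesis
      using that eventually_happens trivial_limit_at_right_real by blast
  qed
  define C' where "C' = max 1 (C * (1 + 2 * \<eta> / \<delta>) ^ k)"
  have C': "C' < 2" "1 \<le> C'" using \<eta> by (auto simp: C'_def)
  define R where "R i = \<kappa> * (\<sigma> * \<theta> (snd i))" for i :: "'a \<times> real"
  \<comment> \<open>For small \<open>\<psi>\<close> the ratio
    \<open>\<theta> \<psi> / \<psi>\<close> is large, because its power with exponent
    \<open>m\<close> is \<open>f \<psi> / \<psi> ^ k\<close>.\<close>
  obtain \<epsilon> where \<epsilon>: "\<epsilon> > 0" "\<And>i. 0 < snd i \<Longrightarrow> snd i < \<epsilon> \<Longrightarrow> 2 * snd i \<le> R i"
  proof -
    obtain \<epsilon> where \<epsilon>: "\<epsilon> > 0" "\<And>r. 0 < r \<Longrightarrow> r \<le> \<epsilon> \<Longrightarrow> (2 / (\<kappa> * \<sigma>)) ^ m * r ^ k \<le> f r"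
      using f_ratio_large[of "(2 / (\<kappa> * \<sigma>)) ^ m"] by auto
    have "2 * snd i \<le> R i" if i: "0 < snd i" "snd i < \<epsilon>" for i :: "'a \<times> real"
    proof -
      have "(2 / (\<kappa> * \<sigma>) * snd i) ^ m * snd i ^ l = (2 / (\<kappa> * \<sigma>)) ^ m * snd i ^ k"
        by (simp add: dim(1)[symmetric] power_add power_mult_distrib power_divide)
      also have "\<dots> \<le> \<theta> (snd i) ^ m * snd i ^ l"
        using \<epsilon>(2)[of "snd i"] i \<theta>(2)[of "snd i"] by simp
      finally have "(2 / (\<kappa> * \<sigma>) * snd i) ^ m \<le> \<theta> (snd i) ^ m"
        using i by simp
      then have "2 / (\<kappa> * \<sigma>) * snd i \<le> \<theta> (snd i)"
        using power_mono_iff[of "2 / (\<kappa> * \<sigma>) * snd i" "\<theta> (snd i)" m] i \<theta>(1)[of "snd i"] dim(2) \<kappa>(1) by simp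
      then show ?thesis using \<kappa>(1) by (simp add: R_def field_simps)
    qed
    then show thesis using that \<epsilon>(1) by blast
  qed
  define K where "K = {i \<in> T N. snd i < \<epsilon> \<and> R i < \<eta> \<and> cball (fst i) (R i) \<subseteq> U}"
  have K: "0 < snd i" "2 * snd i \<le> R i" "0 < R i" "R i < \<eta>" "cball (fst i) (R i) \<subseteq> U" "i \<in> T N" if "i \<in> K" for i
  proof -
    show "0 < snd i" "i \<in> T N" "R i < \<eta>" "cball (fst i) (R i) \<subseteq> U"
      using that T_pos[of "fst i" "snd i" N] by (auto simp: K_def)
    then show "2 * snd i \<le> R i" using \<epsilon>(2)[of i] that by (auto simp: K_def)
    with \<open>0 < snd i\<close> show "0 < R i" by linarith
  qed
  define S where "S = U \<inter> {x. \<forall>d>0. \<exists>i\<in>{i\<in>T N. snd i < \<epsilon>}.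
      0 < \<sigma> * \<theta> (snd i) \<and> \<sigma> * \<theta> (snd i) < d \<and> x \<in> cball (fst i) (\<kappa> * (\<sigma> * \<theta> (snd i)))}"
  have nS: "negligible (U - S)"
    using fine_scaled[OF \<epsilon>(1) \<kappa>(1,2), of N] by (rule negligible_subset) (use U(2) in \<open>auto simp: S_def\<close>)
  have fineK: "\<exists>i. i \<in> K \<and> x \<in> cball (fst i) (R i) \<and> R i < d" if x: "x \<in> S" and d: "0 < d" for x d
  proof -
    obtain s where s: "s > 0" "ball x s \<subseteq> U"
      using x U(1) open_contains_ball unfolding S_def by blast
    define u where "u = min (min \<eta> d) (s / 2)"
    have "u > 0" using s d \<eta> by (simp add: u_def)
    then obtain i where i: "i \<in> T N" "snd i < \<epsilon>" "0 < \<sigma> * \<theta> (snd i)" "\<sigma> * \<theta> (snd i) < u" "x \<in> cball (fst i) (R i)"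
      using x unfolding S_def R_def by blast
    have "R i \<le> 1 * (\<sigma> * \<theta> (snd i))"
      unfolding R_def using \<kappa> i(3) by (intro mult_right_mono) auto
    then have Ru: "R i < u" using i(4) by simp
    have "cball (fst i) (R i) \<subseteq> ball x s"
    proof
      fix z assume "z \<in> cball (fst i) (R i)"
      then have "dist x z \<le> R i + R i"
        using i(5) dist_triangle3[of x z "fst i"] by (simp add: dist_commute)
      then show "z \<in> ball x s" using Ru by (simp add: u_def)
    qed
    then have "i \<in> K" "R i < d" using i Ru s by (auto simp: K_def u_def)
    then show ?thesis using i(5) by blast
  qed
  obtain Q where Q: "countable Q" "Q \<subseteq> K"
      "pairwise (\<lambda>i j. disjnt (cball (fst i) (R i)) (cball (fst j) (R j))) Q"
      "negligible (S - (\<Union>i\<in>Q. cball (fst i) (R i)))"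
    using Vitali_covering_theorem_cballs[of K R S fst, OF K(3) fineK] by blast
  let ?Y = "\<Union>i\<in>Q. cball (fst i) (R i)"
  have Y: "?Y \<in> sets borel" using Q(1) by auto
  have "measure M U \<le> measure M ?Y"
  proof -
    have "negligible (U - ?Y)"
      by (rule negligible_subset[OF negligible_Un[OF nS Q(4)]]) auto
    moreover have b: "U - ?Y \<in> sets borel" using Y U(1) by auto
    ultimately have "emeasure lborel (U - ?Y) = 0"
      by (simp add: negligible_iff_emeasure0 emeasure_completion)
    then have "emeasure M (U - ?Y) = 0" using H(2)[OF b] by simp
    then have "emeasure M ?Y = emeasure M (?Y \<union> (U - ?Y))"
      using b Y by (intro emeasure_Un_null_set[symmetric]) (auto simp: null_sets_def sM)
    also have "\<dots> \<ge> emeasure M U"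
      using b Y U(1) by (intro emeasure_mono) (auto simp: sM)
    finally show ?thesis by (simp add: M.emeasure_eq_measure)
  qed
  then have mY: "m0 < measure M ?Y" using MU by simp
  \<comment> \<open>The mass is strictly above \<open>m0\<close>, so a finite part of the countable
    family still carries more than \<open>m0\<close>. Finiteness keeps the closure of the new
    support inside a finite union of closed balls.\<close>
  obtain I where I: "finite I" "I \<subseteq> Q" "m0 < measure M (\<Union>i\<in>I. cball (fst i) (R i))"
  proof -
    have "Q \<noteq> {}" using mY m0 by auto
    define A where "A n = (\<Union>i\<in>from_nat_into Q ` {..n::nat}. cball (fst i) (R i))" for n
    have "(\<lambda>n. measure M (A n)) \<longlonglongrightarrow> measure M (\<Union>n. A n)"
      by (intro M.finite_Lim_measure_incseq) (auto simp: A_def sM incseq_def, fastforce)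
    also have "(\<Union>n. A n) = ?Y"
    proof -
      have "(\<Union>n. A n) = (\<Union>i\<in>range (from_nat_into Q). cball (fst i) (R i))"
        unfolding A_def by fastforce
      then show ?thesis using range_from_nat_into[OF \<open>Q \<noteq> {}\<close> Q(1)] by simp
    qed
    finally have "eventually (\<lambda>n. m0 < measure M (A n)) sequentially"
      using mY by (rule order_tendstoD(1))
    then obtain n where "m0 < measure M (A n)"
      using eventually_happens by force
    then show thesis
      using that[of "from_nat_into Q ` {..n}"] from_nat_into[OF \<open>Q \<noteq> {}\<close>] unfolding A_def by blast
  qed
  have IK: "i \<in> K" if "i \<in> I" for i using that I Q by auto
  have disjI: "pairwise (\<lambda>i j. disjnt (cball (fst i) (R i)) (cball (fst j) (R j))) I"
    using Q(3) I(2) by (rule pairwise_subset)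
  define w where "w i = measure M (cball (fst i) (R i))" for i
  have w0: "w i \<ge> 0" for i by (simp add: w_def)
  have sumw: "(\<Sum>i\<in>J. w i) = measure M (\<Union>i\<in>J. cball (fst i) (R i))" if "J \<subseteq> I" for J
  proof -
    have "disjoint_family_on (\<lambda>i. cball (fst i) (R i)) J"
      using disjI that unfolding disjoint_family_on_def pairwise_def disjnt_def by blast
    then show ?thesis
      unfolding w_def using that I(1)
      by (intro M.finite_measure_finite_Union[symmetric]) (auto simp: sM intro: finite_subset)
  qed
  \<comment> \<open>The grids use half the radius, so that small balls of radius
    \<open>\<tau> * snd i \<le> R i / 2\<close> remain inside the Vitali ball.\<close>
  have "\<forall>i\<in>I. \<exists>P. finite P \<and> P \<subseteq> cball (fst i) (R i / 2) \<and> (\<forall>z\<in>P. (z, snd i) \<in> T N) \<and>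
      (R i / 2 / (D * snd i)) ^ l \<le> real (card P) \<and>
      (\<forall>b s. snd i \<le> s \<longrightarrow> real (card (P \<inter> cball b s)) \<le> (3 * s / snd i) ^ l)"
  proof
    fix i assume "i \<in> I"
    note K[OF IK[OF this]]
    then show "\<exists>P. finite P \<and> P \<subseteq> cball (fst i) (R i / 2) \<and> (\<forall>z\<in>P. (z, snd i) \<in> T N) \<and>
      (R i / 2 / (D * snd i)) ^ l \<le> real (card P) \<and>
      (\<forall>b s. snd i \<le> s \<longrightarrow> real (card (P \<inter> cball b s)) \<le> (3 * s / snd i) ^ l)"
      by (intro grid) simp_all
  qed
  from bchoice[OF this] obtain P where P': "\<forall>i\<in>I. finite (P i) \<and> P i \<subseteq> cball (fst i) (R i / 2) \<and> (\<forall>z\<in>P i. (z, snd i) \<in> T N) \<and>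
      (R i / 2 / (D * snd i)) ^ l \<le> real (card (P i)) \<and>
      (\<forall>b s. snd i \<le> s \<longrightarrow> real (card (P i \<inter> cball b s)) \<le> (3 * s / snd i) ^ l)"
    by blast
  have P: "finite (P i)" "P i \<subseteq> cball (fst i) (R i / 2)" "\<And>z. z \<in> P i \<Longrightarrow> (z, snd i) \<in> T N"
      "(R i / 2 / (D * snd i)) ^ l \<le> real (card (P i))"
      "\<And>b s. snd i \<le> s \<Longrightarrow> real (card (P i \<inter> cball b s)) \<le> (3 * s / snd i) ^ l" if "i \<in> I" for i
    using bspec[OF P' that] by blast+
  have cP: "0 < real (card (P i))" if "i \<in> I" for i
  proof -
    have "0 < (R i / 2 / (D * snd i)) ^ l" using K[OF IK[OF that]] by simp
    then show ?thesis using P(4)[OF that] by linarith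
  qed
  define c where "c i = w i / (real (card (P i)) * (V * (\<tau> * snd i) ^ k))" for i
  have c0: "0 \<le> c i" if "i \<in> I" for i
    using w0 K(1)[OF IK[OF that]] by (simp add: c_def)
  define B where "B i z = ball z (\<tau> * snd i)" for i :: "'a \<times> real" and z :: 'a
  \<comment> \<open>Small balls of one grid may overlap, and then their densities add up; the grid
    of ball \<open>i\<close> carries mass \<open>w i\<close> in any case.\<close>
  define M' where "M' = density lborel (\<lambda>x. \<Sum>j\<in>Sigma I P. ennreal (c (fst j)) * indicator (B (fst j) (snd j)) x)"
  define \<nu> where "\<nu> i A = (\<Sum>z\<in>P i. c i * measure lborel (A \<inter> B i z))" for i A
  define U' where "U' = (\<Union>i\<in>I. \<Union>z\<in>P i. B i z)"
  have fJ: "finite (Sigma I P)" using I(1) P(1) by auto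
  have M': "emeasure M' A = ennreal (\<Sum>i\<in>I. \<nu> i A)" if "A \<in> sets borel" for A
  proof -
    have "emeasure M' A = ennreal (\<Sum>j\<in>Sigma I P. c (fst j) * measure lborel (A \<inter> B (fst j) (snd j)))"
      unfolding M'_def by (rule emeasure_density_indicators) (use fJ c0 that in \<open>auto simp: B_def\<close>)
    also have "(\<Sum>j\<in>Sigma I P. c (fst j) * measure lborel (A \<inter> B (fst j) (snd j)))
        = (\<Sum>(i, z)\<in>Sigma I P. c i * measure lborel (A \<inter> B i z))"
      by (simp add: case_prod_beta)
    also have "\<dots> = (\<Sum>i\<in>I. \<nu> i A)"
      unfolding \<nu>_def using I(1) P(1) by (intro sum.Sigma[symmetric]) auto
    finally show ?thesis .
  qed
  have \<nu>0: "0 \<le> \<nu> i A" if "i \<in> I" for i A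
    unfolding \<nu>_def using c0[OF that] by (intro sum_nonneg) auto
  have M'r: "measure M' A = (\<Sum>i\<in>I. \<nu> i A)" if "A \<in> sets borel" for A
    using M'[OF that] \<nu>0 by (simp add: measure_def sum_nonneg)
  have volB: "measure lborel (B i z) = V * (\<tau> * snd i) ^ k" if "i \<in> I" for i z
    unfolding B_def using K(1)[OF IK[OF that]] by (simp add: content_ball k V)
  have Bsub: "cball z (\<tau> * snd i) \<subseteq> cball (fst i) (R i)" if "i \<in> I" "z \<in> P i" for i z
  proof -
    have "\<tau> * snd i \<le> 1 * snd i" using K(1)[OF IK[OF that(1)]] by (intro mult_right_mono) auto
    moreover have "dist (fst i) z \<le> R i / 2"
      using subsetD[OF P(2)[OF that(1)] that(2)] by simp
    ultimately show ?thesis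
      using K(2)[OF IK[OF that(1)]] by (auto simp: cball_subset_cball_iff dist_commute)
  qed
  have Bsub': "B i z \<subseteq> cball (fst i) (R i)" if "i \<in> I" "z \<in> P i" for i z
    using Bsub[OF that] ball_subset_cball by (auto simp: B_def)
  have cvol: "real (card (P i)) * (c i * (V * (\<tau> * snd i) ^ k)) = w i" if "i \<in> I" for i
    using cP[OF that] K(1)[OF IK[OF that]] by (simp add: c_def)
  have \<nu>_le: "\<nu> i A \<le> w i" if i: "i \<in> I" and "A \<in> sets borel" for i A
  proof -
    have "\<nu> i A \<le> (\<Sum>z\<in>P i. c i * (V * (\<tau> * snd i) ^ k))"
      unfolding \<nu>_def
    proof (intro sum_mono mult_left_mono c0[OF i])
      fix z
      have "measure lborel (A \<inter> B i z) \<le> measure lborel (B i z)"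
        using that K(1)[OF IK[OF i]]
        by (intro measure_mono_fmeasurable) (auto simp: fmeasurable_def emeasure_ball B_def)
      then show "measure lborel (A \<inter> B i z) \<le> V * (\<tau> * snd i) ^ k" by (simp add: volB i)
    qed
    then show ?thesis using cvol[OF i] by simp
  qed
  have \<nu>_disj: "\<nu> i A = 0" if "i \<in> I" "A \<inter> cball (fst i) (R i) = {}" for i A
    unfolding \<nu>_def
  proof (intro sum.neutral ballI)
    fix z assume "z \<in> P i"
    then have "A \<inter> B i z = {}" using Bsub' that by blast
    then show "c i * measure lborel (A \<inter> B i z) = 0" by simp
  qed
  have \<nu>_full: "\<nu> i U' = w i" if i: "i \<in> I" for i
  proof -
    have "\<nu> i U' = (\<Sum>z\<in>P i. c i * (V * (\<tau> * snd i) ^ k))"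
      unfolding \<nu>_def
    proof (intro sum.cong refl)
      fix z assume "z \<in> P i"
      then have "U' \<inter> B i z = B i z" using i by (auto simp: U'_def)
      then show "c i * measure lborel (U' \<inter> B i z) = c i * (V * (\<tau> * snd i) ^ k)"
        using volB[OF i] by simp
    qed
    then show ?thesis using cvol[OF i] by simp
  qed
  have openU': "open U'" unfolding U'_def B_def by auto
  have clU': "closure U' \<subseteq> U \<inter> E N"
  proof -
    have "closure U' \<subseteq> (\<Union>i\<in>I. \<Union>z\<in>P i. cball z (\<tau> * snd i))"
    proof (rule closure_minimal)
      show "closed (\<Union>i\<in>I. \<Union>z\<in>P i. cball z (\<tau> * snd i))"
        using I(1) P(1) by (intro closed_UN) auto
      show "U' \<subseteq> (\<Union>i\<in>I. \<Union>z\<in>P i. cball z (\<tau> * snd i))"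
        unfolding U'_def B_def by (intro UN_mono ball_subset_cball order_refl)
    qed
    also have "\<dots> \<subseteq> U \<inter> E N"
    proof (intro UN_least Int_greatest)
      fix i z assume iz: "i \<in> I" "z \<in> P i"
      show "cball z (\<tau> * snd i) \<subseteq> U" using Bsub[OF iz] K(5)[OF IK[OF iz(1)]] by blast
      show "cball z (\<tau> * snd i) \<subseteq> E N" using T_target[OF P(3)[OF iz]] .
    qed
    finally show ?thesis .
  qed
  have small: "\<nu> i (cball b r) \<le> grid_mass_const * (H * \<kappa> ^ m) * f r" if i: "i \<in> I" and r: "0 < r" for i b r
    unfolding \<nu>_def c_def B_def
    using K[OF IK[OF i]] \<kappa>(1) r w0[of i] Mball[of "R i" "fst i"] H(1) P(1,4,5)[OF i]
    by (intro grid_mass_le[where R = "R i"]) (auto simp: w_def R_def)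
  \<comment> \<open>The Vitali balls counted are disjoint and lie in the enlarged ball, so their
    weights sum to at most its old mass.\<close>
  have near: "(\<Sum>i\<in>J. w i) \<le> measure M (cball b (r + 2 * t))"
    if J: "J \<subseteq> I" "\<And>i. i \<in> J \<Longrightarrow> R i \<le> t" "\<And>i. i \<in> J \<Longrightarrow> cball b r \<inter> cball (fst i) (R i) \<noteq> {}" for J b r t
    unfolding sumw[OF J(1)]
  proof (intro M.finite_measure_mono UN_least)
    fix i assume i: "i \<in> J"
    obtain x where x: "dist b x \<le> r" "dist (fst i) x \<le> R i"
      using J(3)[OF i] unfolding cball_def by blast
    show "cball (fst i) (R i) \<subseteq> cball b (r + 2 * t)"
    proof
      fix y assume "y \<in> cball (fst i) (R i)"
      then have "dist x y \<le> R i + R i"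
        using x(2) dist_triangle3[of x y "fst i"] by simp
      then show "y \<in> cball b (r + 2 * t)"
        using x(1) J(2)[OF i] dist_triangle[of b y x] by simp
    qed
  qed (simp add: sM)
  have bound: "measure M' (cball b r) \<le> C' * gauge L r" if r: "0 < r" for b r
  proof -
    define J where "J = {i\<in>I. cball b r \<inter> cball (fst i) (R i) \<noteq> {}}"
    have J: "J \<subseteq> I" "finite J" using I(1) by (auto simp: J_def)
    have J': "cball b r \<inter> cball (fst i) (R i) \<noteq> {}" if "i \<in> J" for i
      using that by (simp add: J_def)
    have J\<eta>: "R i \<le> \<eta>" if "i \<in> J" for i
      using K(4)[OF IK[of i]] J(1) that by auto
    have "measure M' (cball b r) = (\<Sum>i\<in>I. \<nu> i (cball b r))" by (rule M'r) simp
    also have "\<dots> = (\<Sum>i\<in>J. \<nu> i (cball b r))"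
      using I(1) \<nu>_disj by (intro sum.mono_neutral_right) (auto simp: J_def)
    finally have eq: "measure M' (cball b r) = (\<Sum>i\<in>J. \<nu> i (cball b r))" .
    have Fr: "0 < gauge L r" "f r \<le> gauge L r" using gauge_pos[OF r] by (auto simp: gauge_def)
    show ?thesis
    proof (cases "r \<le> \<delta>")
      case True
      define J1 where "J1 = {i\<in>J. r \<le> R i}"
      define J2 where "J2 = {i\<in>J. R i < r}"
      have "(\<Sum>i\<in>J. \<nu> i (cball b r)) = (\<Sum>i\<in>J1. \<nu> i (cball b r)) + (\<Sum>i\<in>J2. \<nu> i (cball b r))"
        using J by (subst sum.union_disjoint[symmetric]) (auto simp: J1_def J2_def intro!: sum.cong)
      also have "(\<Sum>i\<in>J1. \<nu> i (cball b r)) \<le> f r / 2"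
      proof -
        have "(\<Sum>i\<in>J1. \<nu> i (cball b r)) \<le> (\<Sum>i\<in>J1. grid_mass_const * (H * \<kappa> ^ m) * f r)"
          using J r by (intro sum_mono small) (auto simp: J1_def)
        also have "\<dots> = real (card J1) * (grid_mass_const * (H * \<kappa> ^ m) * f r)" by simp
        also have "\<dots> \<le> 3 ^ k * (grid_mass_const * (H * \<kappa> ^ m) * f r)"
        proof (intro mult_right_mono)
          show "real (card J1) \<le> 3 ^ k"
            unfolding k using J r
          proof (intro card_disjoint_cballs_le[where a = fst and R = R and r = r and b = b])
            show "pairwise (\<lambda>i j. disjnt (cball (fst i) (R i)) (cball (fst j) (R j))) J1"
              using J(1) by (intro pairwise_subset[OF disjI]) (auto simp: J1_def)
          qed (simp_all add: J1_def J' Int_commute)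
        qed (use grid_mass_const_pos H \<kappa> f_pos[OF r] in auto)
        also have "\<dots> = 3 ^ k * (grid_mass_const * (H * \<kappa> ^ m)) * f r" by simp
        also have "\<dots> \<le> 1 / 2 * f r" using \<kappa>(3) f_pos[OF r] by (intro mult_right_mono) auto
        finally show ?thesis by simp
      qed
      also have "(\<Sum>i\<in>J2. \<nu> i (cball b r)) \<le> f r / 2"
      proof -
        have "(\<Sum>i\<in>J2. \<nu> i (cball b r)) \<le> (\<Sum>i\<in>J2. w i)"
          using J by (intro sum_mono \<nu>_le) (auto simp: J2_def)
        also have "\<dots> \<le> measure M (cball b (r + 2 * r))"
        proof (intro near)
          show "J2 \<subseteq> I" using J by (auto simp: J2_def)
        qed (simp_all add: J2_def J')
        also have "\<dots> \<le> H * (V * (3 * r) ^ k)"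
          using Mball[of "3 * r" b] r by simp
        also have "\<dots> \<le> f r / 2"
          using \<delta>(2)[OF r True] by (simp add: power_mult_distrib mult_ac)
        finally show ?thesis .
      qed
      finally have "measure M' (cball b r) \<le> f r" using eq by simp
      also have "\<dots> \<le> 1 * gauge L r" using Fr by simp
      also have "\<dots> \<le> C' * gauge L r" using C' Fr by (intro mult_right_mono) auto
      finally show ?thesis .
    next
      case False
      have "(\<Sum>i\<in>J. \<nu> i (cball b r)) \<le> (\<Sum>i\<in>J. w i)"
        using J by (intro sum_mono \<nu>_le) auto
      also have "\<dots> \<le> measure M (cball b (r + 2 * \<eta>))"
        by (intro near J(1) J' J\<eta>)
      also have "\<dots> \<le> C * gauge L (r + 2 * \<eta>)"
        using r \<eta> by (intro C) auto
      also have "\<dots> \<le> C * (((r + 2 * \<eta>) / r) ^ k * gauge L r)"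
        using r \<eta> C(1) by (intro mult_left_mono gauge_scale) auto
      also have "\<dots> \<le> C * ((1 + 2 * \<eta> / \<delta>) ^ k * gauge L r)"
      proof (intro mult_left_mono mult_right_mono power_mono)
        have "2 * \<eta> / r \<le> 2 * \<eta> / \<delta>" using False \<delta> \<eta> by (intro divide_left_mono) auto
        then show "(r + 2 * \<eta>) / r \<le> 1 + 2 * \<eta> / \<delta>" using r by (simp add: add_divide_distrib)
      qed (use r \<eta> C(1) Fr in auto)
      also have "\<dots> \<le> C' * gauge L r"
        using Fr unfolding mult.assoc[symmetric] by (intro mult_right_mono) (auto simp: C'_def)
      finally show ?thesis using eq by simp
    qed
  qed
  have "admissible L m0 M' U'"
    unfolding admissible_def
  proof (intro conjI)
    show "sets M' = sets borel" by (simp add: M'_def)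
    show "finite_measure M'"
      using M'[of UNIV] by (intro finite_measureI) (simp add: M'_def)
    show "open U'" by (rule openU')
    show "U' \<subseteq> U0" using clU' U(2) closure_subset[of U'] by blast
    have "\<nu> i (- U') = 0" if "i \<in> I" for i
      unfolding \<nu>_def
    proof (intro sum.neutral ballI)
      fix z assume "z \<in> P i"
      then have "- U' \<inter> B i z = {}" using that by (auto simp: U'_def)
      then show "c i * measure lborel (- U' \<inter> B i z) = 0" by simp
    qed
    then show "emeasure M' (- U') = 0"
      using openU' by (subst M') auto
    show "m0 < measure M' U'"
      using I(3) sumw[of I] \<nu>_full openU' by (subst M'r) auto
    show "\<exists>H\<ge>0. \<forall>A\<in>sets borel. emeasure M' A \<le> ennreal H * emeasure lborel A"
    proof (intro exI[of _ "\<Sum>i\<in>I. \<Sum>z\<in>P i. c i"] conjI ballI)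
      show H'0: "0 \<le> (\<Sum>i\<in>I. \<Sum>z\<in>P i. c i)" using c0 by (intro sum_nonneg) auto
      fix A :: "'a set" assume A: "A \<in> sets borel"
      \<comment> \<open>For infinite volume the right side is \<open>top\<close>, except that
        \<open>0 * top = 0\<close> in \<open>ennreal\<close>; if the constant is 0, all
        \<open>c i\<close> vanish and so does \<open>M'\<close>.\<close>
      show "emeasure M' A \<le> ennreal (\<Sum>i\<in>I. \<Sum>z\<in>P i. c i) * emeasure lborel A"
      proof (cases "emeasure lborel A = \<infinity>")
        case True
        show ?thesis
        proof (cases "(\<Sum>i\<in>I. \<Sum>z\<in>P i. c i) = 0")
          case z: True
          have "\<nu> i A = 0" if "i \<in> I" for i
          proof -
            have "(\<Sum>z\<in>P i. c i) = 0"
              using z that c0 I(1) by (subst (asm) sum_nonneg_eq_0_iff) (auto intro: sum_nonneg)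
            then have "c i = 0" using cP[OF that] by auto
            then show ?thesis by (simp add: \<nu>_def)
          qed
          then show ?thesis using M'[OF A] by simp
        next
          case False
          then show ?thesis using True H'0 by (simp add: ennreal_mult_top)
        qed
      next
        case False
        then have e: "emeasure lborel A = ennreal (measure lborel A)"
          by (simp add: emeasure_eq_ennreal_measure)
        have "(\<Sum>i\<in>I. \<nu> i A) \<le> (\<Sum>i\<in>I. \<Sum>z\<in>P i. c i * measure lborel A)"
          unfolding \<nu>_def
          using c0 A False
          by (intro sum_mono mult_left_mono measure_mono_fmeasurable) (auto simp: fmeasurable_def B_def less_top)
        then show ?thesis
          using H'0 by (simp add: M'[OF A] e sum_distrib_right mult.assoc ennreal_leI flip: ennreal_mult)
      qed
    qed
    show "\<exists>C<2. \<forall>a r. 0 < r \<longrightarrow> measure M' (cball a r) \<le> C * gauge L r"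
      using C' bound by blast
  qed
  then show ?thesis using clU' by blast
qed

section \<open>Lower bounds for Hausdorff measure\<close>

text \<open>The growth bound \<open>gauge_scale\<close> rules out jumps to the right of
  \<open>d > 0\<close>; at \<open>d = 0\<close> the limit of \<open>f\<close> is used. Covering sets
  can therefore be replaced by slightly larger open balls at arbitrarily small extra cost.\<close>

lemma gauge_right_limit:
  assumes f0: "f 0 = 0" "(f \<longlongrightarrow> 0) (at_right 0)" and \<rho>: "0 < \<rho>" and d: "0 \<le> d" "d \<le> \<rho>" and e: "e > 0"
  shows "\<exists>\<delta>>0. gauge (f \<rho> / \<rho> ^ k) (d + \<delta>) \<le> f d + e"
proof -
  have k0: "k > 0" using dim by simp
  have "eventually (\<lambda>\<delta>. gauge (f \<rho> / \<rho> ^ k) (d + \<delta>) < f d + e) (at_right 0)"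
  proof (cases "d = 0")
    case True
    have "((\<lambda>\<delta>. f \<rho> / \<rho> ^ k * \<delta> ^ k) \<longlongrightarrow> f \<rho> / \<rho> ^ k * 0 ^ k) (at_right 0)"
      by (intro tendsto_intros)
    then have "eventually (\<lambda>\<delta>. f \<rho> / \<rho> ^ k * \<delta> ^ k < e) (at_right 0)"
      by (rule order_tendstoD(2)) (use e k0 in \<open>simp add: power_0_left\<close>)
    moreover have "eventually (\<lambda>\<delta>. f \<delta> < e) (at_right 0)"
      using f0(2) e by (rule order_tendstoD(2))
    ultimately show ?thesis
      by eventually_elim (simp add: True f0(1) gauge_def)
  next
    case False
    then have d0: "d > 0" using d by simp
    have "f \<rho> / \<rho> ^ k * d ^ k \<le> f d / d ^ k * d ^ k"
      using f_anti[OF d0 d(2)] d0 by (intro mult_right_mono) auto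
    then have Fd: "gauge (f \<rho> / \<rho> ^ k) d = f d" using d0 by (simp add: gauge_def)
    have "((\<lambda>\<delta>. ((d + \<delta>) / d) ^ k * f d) \<longlongrightarrow> ((d + 0) / d) ^ k * f d) (at_right 0)"
      by (intro tendsto_intros) (use d0 in auto)
    then have "eventually (\<lambda>\<delta>. ((d + \<delta>) / d) ^ k * f d < f d + e) (at_right 0)"
      using e d0 by (intro order_tendstoD(2)) auto
    then show ?thesis
      using eventually_at_right_less[of 0]
    proof eventually_elim
      case (elim \<delta>)
      then show ?case
        using gauge_scale[of d "d + \<delta>" "f \<rho> / \<rho> ^ k"] d0 by (simp add: Fd)
    qed
  qed
  then have "eventually (\<lambda>\<delta>. 0 < \<delta> \<and> gauge (f \<rho> / \<rho> ^ k) (d + \<delta>) < f d + e) (at_right 0)"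
    using eventually_at_right_less[of 0] by eventually_elim simp
  from eventually_happens'[OF trivial_limit_at_right_real this] show ?thesis
    by (auto intro: less_imp_le)
qed

text \<open>With the factor \<open>L / V\<close> a ball of radius \<open>r\<close> gets mass at most
  \<open>L * r ^ k\<close>, the second term of the gauge. Halving the total mass makes the lower
  bound strict.\<close>

lemma admissible_initial:
  assumes "U0 \<noteq> {}" "L > 0"
  shows "\<exists>M. admissible L (L / V * measure lborel U0 / 2) M U0"
proof -
  define M where "M = density lborel (\<lambda>x. \<Sum>j\<in>{()}. ennreal (L / V) * indicator U0 x)"
  have LV: "L / V > 0" using assms V_pos by simp
  have M: "emeasure M A = ennreal (L / V * measure lborel (A \<inter> U0))" if "A \<in> sets borel" for A
    unfolding M_def using LV that U0 by (subst emeasure_density_indicators) auto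
  have Mr: "measure M A = L / V * measure lborel (A \<inter> U0)" if "A \<in> sets borel" for A
    by (simp only: measure_def[of M] M[OF that] enn2real_ennreal[OF mult_nonneg_nonneg[OF less_imp_le[OF LV] measure_nonneg]])
  have fin: "emeasure lborel U0 \<noteq> top" using emeasure_bounded_finite[OF U0(2)] by simp
  have le: "measure lborel (A \<inter> U0) \<le> measure lborel A" if "A \<in> sets borel" "emeasure lborel A \<noteq> top" for A
    using that U0(1) by (intro measure_mono_fmeasurable) (auto simp: fmeasurable_def less_top)
  have "measure lborel U0 > 0"
  proof -
    obtain x s where xs: "s > 0" "ball x s \<subseteq> U0" using assms(1) U0(1) open_contains_ball by blast
    have "0 < measure lborel (ball x s)" using xs by (simp add: content_ball)
    also have "\<dots> \<le> measure lborel U0"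
      using xs fin U0(1) by (intro measure_mono_fmeasurable) (auto simp: fmeasurable_def less_top)
    finally show ?thesis .
  qed
  then have m: "L / V * measure lborel U0 / 2 < measure M U0"
    using mult_pos_pos[OF LV] Mr[OF borel_open[OF U0(1)]] unfolding Int_absorb by fastforce
  have "admissible L (L / V * measure lborel U0 / 2) M U0"
    unfolding admissible_def
  proof (intro conjI)
    show "finite_measure M" using M[of UNIV] by (intro finite_measureI) (simp add: M_def)
    show "sets M = sets borel" by (simp add: M_def)
    show "emeasure M (- U0) = 0" using U0(1) by (subst M) auto
    show "\<exists>H\<ge>0. \<forall>A\<in>sets borel. emeasure M A \<le> ennreal H * emeasure lborel A"
    proof (intro exI[of _ "L / V"] conjI ballI)
      fix A :: "'a set" assume A: "A \<in> sets borel"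
      show "emeasure M A \<le> ennreal (L / V) * emeasure lborel A"
      proof (cases "emeasure lborel A = top")
        case True
        have "ennreal (L / V) \<noteq> 0"
          using LV by (metis ennreal_eq_0_iff not_le)
        from ennreal_top_mult_left[OF this] show ?thesis
          by (simp add: True)
      next
        case False
        then have "emeasure lborel A = ennreal (measure lborel A)"
          by (rule emeasure_eq_ennreal_measure)
        then show ?thesis
          using le[OF A False] LV
          by (simp add: M[OF A] ennreal_leI mult_left_mono del: times_divide_eq_left flip: ennreal_mult)
      qed
    qed (use LV in simp)
    show "\<exists>C<2. \<forall>a r. 0 < r \<longrightarrow> measure M (cball a r) \<le> C * gauge L r"
    proof (intro exI[of _ 1] conjI allI impI)
      fix a r assume r: "(0::real) < r"
      have "measure M (cball a r) \<le> L / V * measure lborel (cball a r)"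
        unfolding Mr[OF borel_closed[OF closed_cball]] using LV r
        by (intro mult_left_mono le) (auto simp: emeasure_cball)
      also have "\<dots> = L * r ^ k"
        using r less_imp_neq[OF V_pos] by (simp add: content_cball k V)
      finally show "measure M (cball a r) \<le> 1 * gauge L r" by (simp add: gauge_def)
    qed simp
  qed (use m U0 in auto)
  then show ?thesis by blast
qed

text \<open>No limit measure is formed. A cover is enlarged to open balls; by compactness finitely
  many of them already cover the closed support at some stage, and the ball bounds of the measure at
  that stage, with constant below 2, are summed over them.\<close>

lemma hausdorff_pre_ge:
  assumes ne: "U0 \<noteq> {}" and f0: "f 0 = 0" "(f \<longlongrightarrow> 0) (at_right 0)" and \<rho>: "0 < \<rho>"
    and \<Lambda>: "U0 \<inter> (\<Inter>N. E N) \<subseteq> \<Lambda>"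
  shows "ennreal (f \<rho> / \<rho> ^ k / V * measure lborel U0 / 4) \<le> hausdorff_pre f \<rho> \<Lambda>"
proof -
  define L where "L = f \<rho> / \<rho> ^ k"
  define m0 where "m0 = L / V * measure lborel U0 / 2"
  have L: "L > 0" using f_pos[OF \<rho>] \<rho> by (simp add: L_def)
  have m0: "m0 \<ge> 0" using L V_pos by (simp add: m0_def)
  have "\<exists>X. \<forall>n. admissible L m0 (fst (X n)) (snd (X n)) \<and> closure (snd (X (Suc n))) \<subseteq> snd (X n) \<inter> E n"
  proof (rule dependent_nat_choice)
    show "\<exists>x. admissible L m0 (fst x) (snd x)"
      using admissible_initial[OF ne L] by (auto simp: m0_def)
    show "\<exists>y. admissible L m0 (fst y) (snd y) \<and> closure (snd y) \<subseteq> snd x \<inter> E n"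
      if "admissible L m0 (fst x) (snd x)" for x n
      using admissible_refine[OF that m0, of n] by auto
  qed
  then obtain X where X: "\<And>n. admissible L m0 (fst (X n)) (snd (X n))"
      "\<And>n. closure (snd (X (Suc n))) \<subseteq> snd (X n) \<inter> E n"
    by blast
  \<comment> \<open>The index is shifted because stage \<open>Suc n\<close> is the one whose closure
    is known to lie in \<open>E n\<close>.\<close>
  define G where "G n = closure (snd (X (Suc n)))" for n
  have G_sub: "G n \<subseteq> U0" "G n \<subseteq> E n" for n
    using X(1)[of n] X(2)[of n] by (auto simp: admissible_def G_def)
  have G_dec: "G n \<subseteq> G m" if "m \<le> n" for m n
  proof -
    have "antimono G"
      unfolding antimono_iff_le_Suc G_def using X(2) closure_subset by fastforce
    then show ?thesis using that by (rule antimonoD)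
  qed
  have G_compact: "compact (G n)" for n
    using G_sub(1)[of n] U0(2) by (auto simp: compact_eq_bounded_closed G_def intro: bounded_subset)
  have "ennreal (m0 / 2) \<le> (\<Sum>i. ennreal (f (diameter (W i))))"
    if W: "\<And>i. bounded (W i)" "\<And>i. diameter (W i) \<le> \<rho>" "\<Lambda> \<subseteq> (\<Union>i. W i)" for W :: "nat \<Rightarrow> 'a set"
  proof (rule ennreal_le_epsilon)
    fix e :: real assume e: "e > 0"
    define d where "d i = diameter (W i)" for i
    have d: "0 \<le> d i" "d i \<le> \<rho>" for i
      using W by (auto simp: d_def diameter_ge_0)
    \<comment> \<open>The errors \<open>e * (1/2) ^ Suc i\<close> sum to \<open>e\<close> over all
      \<open>i\<close>.\<close>
    have "\<forall>i. \<exists>\<delta>>0. gauge L (d i + \<delta>) \<le> f (d i) + e * (1/2) ^ Suc i"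
      unfolding L_def using d e by (intro allI gauge_right_limit f0 \<rho>) auto
    then obtain \<delta> where \<delta>: "\<And>i. \<delta> i > 0" "\<And>i. gauge L (d i + \<delta> i) \<le> f (d i) + e * (1/2) ^ Suc i"
      by metis
    have "\<forall>i. \<exists>x. W i \<subseteq> ball x (d i + \<delta> i)"
    proof
      fix i
      show "\<exists>x. W i \<subseteq> ball x (d i + \<delta> i)"
      proof (cases "W i = {}")
        case False
        then obtain x where "x \<in> W i" by blast
        then have "W i \<subseteq> ball x (d i + \<delta> i)"
          using diameter_bounded_bound[OF W(1), of x i] \<delta>(1)[of i] by (force simp: d_def)
        then show ?thesis by blast
      qed simp
    qed
    then obtain x where x: "\<And>i. W i \<subseteq> ball (x i) (d i + \<delta> i)" by metis
    let ?O = "\<lambda>i. ball (x i) (d i + \<delta> i)"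
    have "(\<Inter>n. G n) \<subseteq> U0 \<inter> (\<Inter>N. E N)" using G_sub by blast
    then have sub: "(\<Inter>n. G n) \<subseteq> (\<Union>i. ?O i)"
      using \<Lambda> W(3) UN_mono[OF subset_refl[of UNIV], of W ?O, OF x] by order
    \<comment> \<open>Otherwise the decreasing nonempty compact sets of uncovered points would have
      a common point, against \<open>sub\<close>.\<close>
    obtain n where n: "G n \<subseteq> (\<Union>i. ?O i)"
    proof (rule ccontr)
      assume "\<not> thesis"
      then have "G n - (\<Union>i. ?O i) \<noteq> {}" for n using that by blast
      moreover have "G n - (\<Union>i. ?O i) \<subseteq> G m - (\<Union>i. ?O i)" if "m \<le> n" for m n
        using G_dec[OF that] by blast
      ultimately have "(\<Inter>n. G n - (\<Union>i. ?O i)) \<noteq> {}"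
        using G_compact by (intro compact_nest compact_diff) auto
      then show False using sub by blast
    qed
    obtain I where I: "finite I" "G n \<subseteq> (\<Union>i\<in>I. ?O i)"
      by (rule compactE_image[OF G_compact[of n] open_ball n])
    let ?M = "fst (X (Suc n))"
    have M: "finite_measure ?M" "sets ?M = sets borel" "m0 < measure ?M (snd (X (Suc n)))"
      and "\<exists>C<2. \<forall>a r. 0 < r \<longrightarrow> measure ?M (cball a r) \<le> C * gauge L r"
      using X(1)[of "Suc n"] by (auto simp: admissible_def)
    then obtain C where C: "C < 2" "\<And>a r. 0 < r \<Longrightarrow> measure ?M (cball a r) \<le> C * gauge L r"
      by blast
    interpret M: finite_measure ?M by (rule M(1))
    have "snd (X (Suc n)) \<subseteq> (\<Union>i\<in>I. cball (x i) (d i + \<delta> i))"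
      using I(2) closure_subset[of "snd (X (Suc n))"] ball_subset_cball unfolding G_def by blast
    moreover have "(\<Union>i\<in>I. cball (x i) (d i + \<delta> i)) \<in> sets ?M"
      unfolding M(2) using I(1) by (intro borel_closed closed_UN) auto
    ultimately have "m0 < measure ?M (\<Union>i\<in>I. cball (x i) (d i + \<delta> i))"
      by (rule less_le_trans[OF M(3) M.finite_measure_mono])
    also have "\<dots> \<le> (\<Sum>i\<in>I. measure ?M (cball (x i) (d i + \<delta> i)))"
    proof (rule M.finite_measure_subadditive_finite[OF I(1)])
      show "(\<lambda>i. cball (x i) (d i + \<delta> i)) ` I \<subseteq> sets ?M"
        unfolding M(2) by (intro image_subsetI borel_closed closed_cball)
    qed
    also have "\<dots> \<le> (\<Sum>i\<in>I. 2 * (f (d i) + e * (1/2) ^ Suc i))"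
    proof (rule sum_mono)
      fix i
      have pos: "0 < d i + \<delta> i" using d(1)[of i] \<delta>(1)[of i] by simp
      have "measure ?M (cball (x i) (d i + \<delta> i)) \<le> C * gauge L (d i + \<delta> i)"
        using pos by (rule C)
      also have "\<dots> \<le> 2 * gauge L (d i + \<delta> i)"
        using C(1) gauge_pos[OF pos, of L] by (intro mult_right_mono) auto
      also have "\<dots> \<le> 2 * (f (d i) + e * (1/2) ^ Suc i)"
        using \<delta>(2)[of i] by simp
      finally show "measure ?M (cball (x i) (d i + \<delta> i)) \<le> 2 * (f (d i) + e * (1/2) ^ Suc i)" .
    qed
    also have "\<dots> = 2 * ((\<Sum>i\<in>I. f (d i)) + e * (\<Sum>i\<in>I. (1/2) ^ Suc i))"
      by (simp only: sum_distrib_left[symmetric] sum.distrib)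
    also have "\<dots> \<le> 2 * ((\<Sum>i\<in>I. f (d i)) + e * 1)"
    proof -
      have "(\<Sum>i\<in>I. (1/2) ^ Suc i) \<le> (1::real)"
        using sum_le_suminf[OF sums_summable[OF power_half_series] I(1)] sums_unique[OF power_half_series] by simp
      then show ?thesis using e by simp
    qed
    finally have "m0 / 2 \<le> (\<Sum>i\<in>I. f (d i)) + e" by simp
    moreover have fd: "0 \<le> f (d i)" for i
      using f_pos[of "d i"] d(1)[of i] f0(1) by (cases "d i = 0") auto
    ultimately have "ennreal (m0 / 2) \<le> (\<Sum>i\<in>I. ennreal (f (d i))) + ennreal e"
      using e by (simp add: sum_ennreal sum_nonneg ennreal_leI flip: ennreal_plus)
    also have "\<dots> \<le> (\<Sum>i. ennreal (f (diameter (W i)))) + ennreal e"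
      unfolding d_def using I(1) by (intro add_right_mono sum_le_suminf) auto
    finally show "ennreal (m0 / 2) \<le> (\<Sum>i. ennreal (f (diameter (W i)))) + ennreal e" .
  qed
  then have "ennreal (m0 / 2) \<le> hausdorff_pre f \<rho> \<Lambda>"
    unfolding hausdorff_pre_def by (intro INF_greatest) auto
  then show ?thesis by (simp add: m0_def L_def mult_ac)
qed

text \<open>The content at scale \<open>\<rho>\<close> is at least a fixed multiple of
  \<open>f \<rho> / \<rho> ^ k\<close>, which is unbounded, and every \<open>\<rho> > 0\<close>
  enters the supremum.\<close>

lemma hausdorff_measure_top:
  assumes ne: "U0 \<noteq> {}" and f0: "f 0 = 0" "(f \<longlongrightarrow> 0) (at_right 0)"
    and \<Lambda>: "U0 \<inter> (\<Inter>N. E N) \<subseteq> \<Lambda>"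
  shows "hausdorff_measure f \<Lambda> = top"
proof (rule ccontr)
  assume "hausdorff_measure f \<Lambda> \<noteq> top"
  then obtain h where h: "hausdorff_measure f \<Lambda> = ennreal h" "h \<ge> 0"
    by (cases "hausdorff_measure f \<Lambda>") auto
  have pos: "0 < measure lborel U0 / (4 * V)"
  proof -
    obtain x s where xs: "s > 0" "ball x s \<subseteq> U0" using ne U0(1) open_contains_ball by blast
    have "0 < measure lborel (ball x s)" using xs by (simp add: content_ball)
    also have "\<dots> \<le> measure lborel U0"
      using xs emeasure_bounded_finite[OF U0(2)] U0(1)
      by (intro measure_mono_fmeasurable) (auto simp: fmeasurable_def)
    finally show ?thesis using V_pos by simp
  qed
  \<comment> \<open>Chosen so that the lower bound for the content reaches
    \<open>h + 1\<close>.\<close>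
  define B where "B = (h + 1) / (measure lborel U0 / (4 * V))"
  obtain \<rho> where \<rho>: "\<rho> > 0" "B \<le> f \<rho> / \<rho> ^ k"
    using f_unbounded by blast
  have "h + 1 = B * (measure lborel U0 / (4 * V))" unfolding B_def
    using less_imp_neq[OF pos, symmetric] by (rule nonzero_eq_divide_eq[THEN iffD1, OF _ refl, symmetric])
  also have "\<dots> \<le> f \<rho> / \<rho> ^ k * (measure lborel U0 / (4 * V))"
    using \<rho>(2) pos by (intro mult_right_mono) auto
  also have "\<dots> = f \<rho> / \<rho> ^ k / V * measure lborel U0 / 4" by simp
  finally have "ennreal (h + 1) \<le> hausdorff_pre f \<rho> \<Lambda>"
    using hausdorff_pre_ge[OF ne f0 \<rho>(1) \<Lambda>] by (meson ennreal_leI order_trans)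
  also have "\<dots> \<le> hausdorff_measure f \<Lambda>"
    unfolding hausdorff_measure_def using \<rho>(1) by (intro SUP_upper) auto
  finally have "ennreal (h + 1) \<le> ennreal h" unfolding h(1) .
  then have "h + 1 \<le> h" using ennreal_le_iff[OF h(2)] by blast
  then show False by simp
qed

end

section \<open>Systems of linear forms\<close>

text \<open>\<open>\<theta> r\<close> stands for \<open>g r powr (1 / m)\<close>. With
  \<open>\<psi> = \<Psi> (p, q) / height q\<close>, the inflated slab has half-width
  \<open>height q * \<theta> \<psi>\<close> in the values of the form, thus of order
  \<open>\<theta> \<psi>\<close> in the space of matrices.\<close>

locale linear_forms =
  fixes \<Psi> :: "(int^'m) \<times> (int^'n) \<Rightarrow> real" and y :: "real^'m" and \<Phi> :: "real^'m^'m"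
    and f \<theta> :: "real \<Rightarrow> real" and l m n :: nat
  assumes card: "m = CARD('m)" "n = CARD('n)" "l = (n - 1) * m"
    and \<Psi>_nonneg: "\<And>p q. (p, q) \<noteq> 0 \<Longrightarrow> 0 \<le> \<Psi> (p, q)"
    and \<Psi>_small: "\<And>\<epsilon>. \<epsilon> > 0 \<Longrightarrow> \<exists>N. \<forall>p q. height q \<ge> N \<longrightarrow> \<Psi> (p, q) / height q < \<epsilon>"
    and f0: "f 0 = 0" "(f \<longlongrightarrow> 0) (at_right 0)"
    and f_nonneg: "\<And>r. 0 \<le> r \<Longrightarrow> 0 \<le> f r" and f_mono: "\<And>r s. 0 \<le> r \<Longrightarrow> r \<le> s \<Longrightarrow> f r \<le> f s"
    and g_mono: "\<And>r s. 0 < r \<Longrightarrow> r \<le> s \<Longrightarrow> f r / r ^ l \<le> f s / s ^ l"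
    and g0: "((\<lambda>r. f r / r ^ l) \<longlongrightarrow> 0) (at_right 0)"
    and \<theta>: "\<And>r. 0 \<le> r \<Longrightarrow> 0 \<le> \<theta> r" "\<theta> 0 = 0" "\<And>r. 0 < r \<Longrightarrow> \<theta> r ^ m * r ^ l = f r"
    and full: "negligible (unit_cube - approximable_set y \<Phi> (\<lambda>(p, q). height q * \<theta> (\<Psi> (p, q) / height q)))"
begin

section \<open>Points on the planes and the slabs around them\<close>

text \<open>Up to a constant, the second component is the half-width of the
  \<open>\<Psi>\<close>-slab in the space of matrices. The bound \<open>1 \<le> height q\<close>
  excludes \<open>q = 0\<close> and permits division, and \<open>0 < \<psi>\<close> leaves out empty
  slabs.\<close>

definition pts :: "nat \<Rightarrow> ((real^'m^'n) \<times> real) set" where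
  "pts N = {(a, \<psi>). 0 < \<psi> \<and> (\<exists>p q. 1 \<le> height q \<and> real N \<le> height q \<and>
     real_vec q v* a + (real_vec p v* \<Phi> - y) = 0 \<and> \<psi> = \<Psi> (p, q) / height q)}"

definition slabs :: "nat \<Rightarrow> (real^'m^'n) set" where
  "slabs N = {x. \<exists>p q. (p, q) \<noteq> 0 \<and> real N \<le> height q \<and>
     infnorm (real_vec q v* x + real_vec p v* \<Phi> - y) < \<Psi> (p, q)}"

lemma card_pos: "0 < m" "0 < n"
  by (simp_all add: card)

lemma dim: "l + m = DIM(real^'m^'n)"
proof -
  have "l + m = n * m"
    using card(3) card_pos by (cases n) auto
  then show ?thesis by (simp add: card)
qed

lemma nonzero: "1 \<le> height q \<Longrightarrow> (p, q) \<noteq> 0"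
  by (auto simp: real_vec_def zero_prod_def infnorm_0 zero_vec_def[symmetric])

lemma \<theta>_small: "d > 0 \<Longrightarrow> \<exists>\<epsilon>>0. \<forall>r. 0 < r \<and> r < \<epsilon> \<longrightarrow> \<theta> r < d"
proof -
  assume d: "d > 0"
  then have "eventually (\<lambda>r. f r / r ^ l < d ^ m) (at_right 0)"
    using g0 by (intro order_tendstoD(2)) auto
  then obtain \<epsilon> where \<epsilon>: "\<epsilon> > 0" "\<And>r. 0 < r \<Longrightarrow> r < \<epsilon> \<Longrightarrow> f r / r ^ l < d ^ m"
    by (auto simp: eventually_at_right_field)
  have "\<theta> r < d" if r: "0 < r" "r < \<epsilon>" for r
  proof -
    have "\<theta> r ^ m = f r / r ^ l" using \<theta>(3)[OF r(1)] r(1) by (simp add: field_simps)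
    then have "\<theta> r ^ m < d ^ m" using \<epsilon>(2)[OF r] by simp
    then show ?thesis using d by (rule power_less_imp_less_base[OF _ less_imp_le])
  qed
  then show ?thesis using \<epsilon>(1) by blast
qed

text \<open>Multiplication by \<open>real_vec q\<close> enlarges norms by a factor of at most
  \<open>n * height q\<close>, and the 2 in the denominator makes the inequality strict.\<close>

lemma pts_slabs:
  assumes "(a, \<psi>) \<in> pts N"
  shows "cball a (1 / (2 * real n) * \<psi>) \<subseteq> slabs N"
proof
  fix x assume x: "x \<in> cball a (1 / (2 * real n) * \<psi>)"
  obtain p q where pq: "0 < \<psi>" "1 \<le> height q" "real N \<le> height q"
      "real_vec q v* a + (real_vec p v* \<Phi> - y) = 0" "\<psi> = \<Psi> (p, q) / height q"
    using assms by (auto simp: pts_def)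
  have "real_vec q v* x + real_vec p v* \<Phi> - y = real_vec q v* (x - a)"
    using pq(4) by (simp add: vector_matrix_mult_diff_distrib algebra_simps)
  also have "infnorm \<dots> \<le> real n * height q * norm (x - a)"
    unfolding card by (rule infnorm_vector_matrix_mult_le)
  also have "\<dots> \<le> real n * height q * (1 / (2 * real n) * \<psi>)"
    using x pq by (intro mult_left_mono) (auto simp: dist_norm norm_minus_commute)
  also have "\<dots> = \<Psi> (p, q) / 2"
    using pq card_pos by simp
  also have "\<dots> < \<Psi> (p, q)"
    using pq by (simp add: zero_less_divide_iff)
  finally show "x \<in> slabs N"
    using nonzero[OF pq(2)] pq(3) unfolding slabs_def by blast
qed

lemma pts_grid:
  assumes "(a, \<psi>) \<in> pts N" "\<psi> \<le> r"
  shows "\<exists>P. finite P \<and> P \<subseteq> cball a r \<and> (\<forall>z\<in>P. (z, \<psi>) \<in> pts N) \<and>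
    (r / (real n * real n * real m * \<psi>)) ^ l \<le> real (card P) \<and>
    (\<forall>b s. \<psi> \<le> s \<longrightarrow> real (card (P \<inter> cball b s)) \<le> (3 * s / \<psi>) ^ l)"
proof -
  obtain p q where pq: "0 < \<psi>" "1 \<le> height q" "real N \<le> height q"
      "real_vec q v* a + (real_vec p v* \<Phi> - y) = 0" "\<psi> = \<Psi> (p, q) / height q"
    using assms by (auto simp: pts_def)
  have h: "0 < height q" using pq(2) by linarith
  have "\<exists>P. finite P \<and> P \<subseteq> cball a r \<and> (\<forall>x\<in>P. real_vec q v* x + (real_vec p v* \<Phi> - y) = 0) \<and>
      (r / (real n * real n * real m * \<psi>)) ^ l \<le> real (card P) \<and>
      (\<forall>b s. \<psi> \<le> s \<longrightarrow> real (card (P \<inter> cball b s)) \<le> (3 * s / \<psi>) ^ l)"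
    unfolding card by (rule affine_plane_grid[OF h pq(4,1) assms(2)])
  then obtain P where P: "finite P" "P \<subseteq> cball a r" "\<forall>x\<in>P. real_vec q v* x + (real_vec p v* \<Phi> - y) = 0"
      "(r / (real n * real n * real m * \<psi>)) ^ l \<le> real (card P)"
      "\<forall>b s. \<psi> \<le> s \<longrightarrow> real (card (P \<inter> cball b s)) \<le> (3 * s / \<psi>) ^ l"
    by blast
  have "\<forall>z\<in>P. (z, \<psi>) \<in> pts N"
    using P(3) pq unfolding pts_def by blast
  then show ?thesis
    using P by (intro exI[of _ P] conjI)
qed

text \<open>A solution with large \<open>height q\<close> makes \<open>\<psi>\<close>, and hence
  \<open>\<theta> \<psi>\<close>, small uniformly in \<open>p\<close>. By
  \<open>near_affine_plane\<close> the plane has a point within \<open>m * \<theta> \<psi>\<close>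
  of \<open>x\<close>, whence the constant \<open>real m\<close>.\<close>

lemma pts_fine:
  assumes x: "x \<in> approximable_set y \<Phi> (\<lambda>(p, q). height q * \<theta> (\<Psi> (p, q) / height q))"
    and "\<epsilon> > 0" "d > 0"
  shows "\<exists>i\<in>{i \<in> pts N. snd i < \<epsilon>}. 0 < real m * \<theta> (snd i) \<and> real m * \<theta> (snd i) < d \<and>
    x \<in> cball (fst i) (real m * \<theta> (snd i))"
proof -
  obtain \<epsilon>' where \<epsilon>': "\<epsilon>' > 0" "\<And>r. 0 < r \<Longrightarrow> r < \<epsilon>' \<Longrightarrow> \<theta> r < d / real m"
    using \<theta>_small[of "d / real m"] assms card_pos by auto
  obtain N0 where N0: "\<And>p q. height q \<ge> N0 \<Longrightarrow> \<Psi> (p, q) / height q < min \<epsilon> \<epsilon>'"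
    using \<Psi>_small[of "min \<epsilon> \<epsilon>'"] \<epsilon>'(1) assms by auto
  obtain p q where pq: "height q \<ge> max N0 (max 1 (real N))"
      "infnorm (real_vec q v* x + real_vec p v* \<Phi> - y) < height q * \<theta> (\<Psi> (p, q) / height q)"
    using x unfolding approximable_set_def mem_Collect_eq case_prod_conv
    by (elim conjE allE[of _ "max N0 (max 1 (real N))"]) blast
  define \<psi> where "\<psi> = \<Psi> (p, q) / height q"
  have h: "height q \<ge> 1" "height q > 0" using pq(1) by auto
  \<comment> \<open>The strict inequality satisfied by \<open>p\<close> and \<open>q\<close> forces
    \<open>\<theta> \<psi> > 0\<close>, and \<open>\<theta> 0 = 0\<close> then rules out
    \<open>\<psi> = 0\<close>.\<close>
  have "0 \<le> infnorm (real_vec q v* x + real_vec p v* \<Phi> - y)" by (rule infnorm_pos_le)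
  then have "0 < height q * \<theta> \<psi>" using pq(2) unfolding \<psi>_def by linarith
  then have \<theta>\<psi>: "0 < \<theta> \<psi>" using h by (simp add: zero_less_mult_iff)
  have "0 \<le> \<psi>" using \<Psi>_nonneg[OF nonzero[OF h(1)]] h by (simp add: \<psi>_def)
  then have \<psi>: "0 < \<psi>" using \<theta>\<psi> \<theta>(2) by (cases "\<psi> = 0") auto
  have small: "\<psi> < \<epsilon>" "\<psi> < \<epsilon>'" using N0[of q p] pq(1) by (auto simp: \<psi>_def)
  obtain z where z: "real_vec q v* z + (real_vec p v* \<Phi> - y) = 0"
      "dist x z \<le> real CARD('m) * (infnorm (real_vec q v* x + (real_vec p v* \<Phi> - y)) / height q)"
    by (rule near_affine_plane[OF h(2)])
  note z(2)
  also have "real CARD('m) * (infnorm (real_vec q v* x + (real_vec p v* \<Phi> - y)) / height q) \<le> real m * \<theta> \<psi>"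
    unfolding card using pq(2) h
    by (intro mult_left_mono) (auto simp: \<psi>_def pos_divide_le_eq mult.commute add_diff_eq)
  finally have "x \<in> cball z (real m * \<theta> \<psi>)" by (simp add: dist_commute)
  moreover have "(z, \<psi>) \<in> pts N"
    using \<psi> z(1) pq(1) unfolding pts_def \<psi>_def by auto
  moreover have "real m * \<theta> \<psi> < d"
    using \<epsilon>'(2)[OF \<psi> small(2)] card_pos by (simp add: field_simps)
  ultimately show ?thesis
    using small(1) \<theta>\<psi> card_pos by (intro bexI[of _ "(z, \<psi>)"]) auto
qed

lemma pts_fine_ae:
  assumes "\<epsilon> > 0"
  shows "negligible (box 0 One - {x. \<forall>d>0. \<exists>i\<in>{i \<in> pts N. snd i < \<epsilon>}.
    0 < real m * \<theta> (snd i) \<and> real m * \<theta> (snd i) < d \<and> x \<in> cball (fst i) (real m * \<theta> (snd i))})"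
proof (rule negligible_subset[OF full], intro Diff_mono box_subset_cbox subsetI CollectI allI impI)
  fix x d assume "x \<in> approximable_set y \<Phi> (\<lambda>(p, q). height q * \<theta> (\<Psi> (p, q) / height q))" "0 < (d::real)"
  then show "\<exists>i\<in>{i \<in> pts N. snd i < \<epsilon>}. 0 < real m * \<theta> (snd i) \<and> real m * \<theta> (snd i) < d \<and>
      x \<in> cball (fst i) (real m * \<theta> (snd i))"
    by (intro pts_fine assms)
qed

lemma slabs_approximable: "box 0 One \<inter> (\<Inter>N. slabs N) \<subseteq> approximable_set y \<Phi> \<Psi>"
proof
  fix x assume x: "x \<in> box 0 One \<inter> (\<Inter>N. slabs N)"
  have "\<exists>p q. (p, q) \<noteq> 0 \<and> height q \<ge> N \<and> infnorm (real_vec q v* x + real_vec p v* \<Phi> - y) < \<Psi> (p, q)" for N :: real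
  proof -
    have "x \<in> slabs (nat \<lceil>N\<rceil>)" using x by blast
    then obtain p q where "(p, q) \<noteq> 0" "real (nat \<lceil>N\<rceil>) \<le> height q"
        "infnorm (real_vec q v* x + real_vec p v* \<Phi> - y) < \<Psi> (p, q)"
      unfolding slabs_def by blast
    then show ?thesis using real_nat_ceiling_ge[of N] by (meson order_trans)
  qed
  then show "x \<in> approximable_set y \<Phi> \<Psi>"
    using x box_subset_cbox unfolding approximable_set_def by blast
qed

section \<open>The two regimes of the dimension function\<close>

lemma hausdorff_measure_unbounded:
  assumes anti: "\<And>r s. 0 < r \<Longrightarrow> r \<le> s \<Longrightarrow> f s / s ^ (l + m) \<le> f r / r ^ (l + m)"
    and unb: "\<And>B. \<exists>r>0. B \<le> f r / r ^ (l + m)"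
  shows "hausdorff_measure f (approximable_set y \<Phi> \<Psi>) = top"
proof -
  \<comment> \<open>One scale \<open>s\<close> with positive ratio suffices: above it
    \<open>f\<close> is non-decreasing, below it the ratio is antitone.\<close>
  have f_pos: "0 < f r" if r: "0 < r" for r
  proof -
    obtain s where s: "s > 0" "1 \<le> f s / s ^ (l + m)" using unb by blast
    have fs: "0 < f s / s ^ (l + m)" using s(2) by linarith
    show ?thesis
    proof (cases "s \<le> r")
      case True
      then show ?thesis using fs s(1) f_mono[of s r] by (simp add: zero_less_divide_iff)
    next
      case False
      then have "0 < f r / r ^ (l + m)" using less_le_trans[OF fs anti[OF r]] by simp
      then show ?thesis using r by (simp add: zero_less_divide_iff)
    qed
  qed
  \<comment> \<open>The constant \<open>D\<close> comes from \<open>affine_plane_grid\<close>,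
    \<open>\<sigma> = m\<close> from \<open>near_affine_plane\<close>, and
    \<open>\<tau> = 1 / (2 * n)\<close> from \<open>pts_slabs\<close>.\<close>
  interpret mass_transference f \<theta> "DIM(real^'m^'n)" l m "unit_ball_vol (real DIM(real^'m^'n))"
    "real n * real n * real m" "real m" "1 / (2 * real n)" pts slabs "box 0 One"
  proof
    show "0 < \<theta> \<psi>" if "0 < \<psi>" for \<psi>
    proof -
      have "\<theta> \<psi> \<noteq> 0"
        using \<theta>(3)[OF that] f_pos[OF that] card_pos by (auto simp: power_0_left)
      then show ?thesis using \<theta>(1)[of \<psi>] that by simp
    qed
    show "1 / (2 * real n) \<le> 1" "0 < 1 / (2 * real n)" "0 < real n * real n * real m" "0 < real m" "0 < m"
      using card_pos by (simp_all add: field_simps)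
    show "l + m = DIM(real^'m^'n)" by (rule dim)
    show "f s / s ^ DIM(real^'m^'n) \<le> f r / r ^ DIM(real^'m^'n)" if "0 < r" "r \<le> s" for r s
      using anti[OF that] unfolding dim .
    show "\<exists>r>0. B \<le> f r / r ^ DIM(real^'m^'n)" for B
      using unb[of B] unfolding dim .
    show "0 < \<psi>" if "(a, \<psi>) \<in> pts N" for N a \<psi>
      using that by (simp add: pts_def)
    show "open (box 0 One :: (real^'m^'n) set)" by (rule open_box)
    show "bounded (box 0 One :: (real^'m^'n) set)" by (rule bounded_box)
  qed (fact refl f_pos g_mono \<theta>(3) pts_slabs pts_grid pts_fine_ae)+
  show ?thesis
    by (rule hausdorff_measure_top[OF _ f0 slabs_approximable]) (simp add: box_ne_empty)
qed

text \<open>Near 0 one has \<open>\<theta> r \<le> c * r\<close>, so the balls of radius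
  \<open>m * \<theta> \<psi>\<close>, shrunk by a fixed factor, lie in the balls of
  \<open>pts_slabs\<close>; by \<open>negligible_fine_cover_scale\<close> the shrinking loses only a
  null set.\<close>

lemma hausdorff_measure_bounded:
  assumes bdd: "r0 > 0" "\<And>r. 0 < r \<Longrightarrow> r \<le> r0 \<Longrightarrow> f r \<le> K * r ^ (l + m)"
  shows "hausdorff_measure f (approximable_set y \<Phi> \<Psi>) = hausdorff_measure f (unit_cube :: (real^'m^'n) set)"
proof -
  \<comment> \<open>At least 1, so that \<open>c \<le> c ^ m\<close> and roots of order
    \<open>m\<close> can be compared.\<close>
  define c where "c = max 1 K"
  have c: "1 \<le> c" by (simp add: c_def)
  have \<theta>_le: "\<theta> r \<le> c * r" if r: "0 < r" "r < r0" for r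
  proof -
    have "K * r ^ (l + m) \<le> c * r ^ (l + m)"
      using r by (intro mult_right_mono) (auto simp: c_def)
    then have "\<theta> r ^ m * r ^ l \<le> c * r ^ (l + m)"
      using bdd(2)[of r] \<theta>(3)[of r] r by linarith
    then have "\<theta> r ^ m \<le> c * r ^ m"
      using r by (simp add: power_add mult.assoc[symmetric] mult.commute[of "r ^ l"])
    also have "\<dots> \<le> c ^ m * r ^ m"
      using c r card_pos self_le_power[of c m] by (intro mult_right_mono) auto
    finally have "\<theta> r ^ m \<le> (c * r) ^ m" by (simp add: power_mult_distrib)
    then show ?thesis
      using power_mono_iff[of "\<theta> r" "c * r" m] \<theta>(1)[of r] c r card_pos by simp
  qed
  \<comment> \<open>The solution of
    \<open>\<kappa> * (m * (c * \<psi>)) = 1 / (2 * n) * \<psi>\<close>, the radius in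
    \<open>pts_slabs\<close>.\<close>
  define \<kappa> where "\<kappa> = 1 / (2 * real n * real m * c)"
  have nmc: "1 \<le> 2 * real n * real m * c"
  proof -
    have "1 * 1 \<le> 2 * real n * real m" using card_pos by (intro mult_mono) auto
    then have "1 * 1 \<le> 2 * real n * real m * c" using c by (intro mult_mono) auto
    then show ?thesis by simp
  qed
  then have pos: "0 < 2 * real n * real m * c" by linarith
  have \<kappa>: "0 < \<kappa>" "\<kappa> \<le> 1"
    unfolding \<kappa>_def using divide_pos_pos[OF zero_less_one pos] divide_le_eq_1_pos[OF pos, of 1] nmc by blast+
  have "negligible (box 0 One - slabs N)" for N
  proof (rule negligible_subset)
    show "negligible (box 0 One - {x. \<forall>d>0. \<exists>i\<in>{i \<in> pts N. snd i < r0}.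
      0 < real m * \<theta> (snd i) \<and> real m * \<theta> (snd i) < d \<and> x \<in> cball (fst i) (\<kappa> * (real m * \<theta> (snd i)))})"
      by (rule negligible_fine_cover_scale[OF _ \<kappa> pts_fine_ae[OF bdd(1)]]) simp
    have in_slabs: "x \<in> slabs N" if i: "(a, \<psi>) \<in> pts N" "\<psi> < r0" "x \<in> cball a (\<kappa> * (real m * \<theta> \<psi>))" for x a \<psi>
    proof -
      have \<psi>: "0 < \<psi>" using i(1) by (simp add: pts_def)
      have "\<kappa> * (real m * \<theta> \<psi>) \<le> \<kappa> * (real m * (c * \<psi>))"
        using \<theta>_le[OF \<psi> i(2)] \<kappa> by (intro mult_left_mono) auto
      also have "\<dots> = 1 / (2 * real n) * \<psi>"
        using card_pos c by (simp add: \<kappa>_def)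
      finally show ?thesis using pts_slabs[OF i(1)] i(3) by auto
    qed
    show "box 0 One - slabs N \<subseteq> box 0 One - {x. \<forall>d>0. \<exists>i\<in>{i \<in> pts N. snd i < r0}.
      0 < real m * \<theta> (snd i) \<and> real m * \<theta> (snd i) < d \<and> x \<in> cball (fst i) (\<kappa> * (real m * \<theta> (snd i)))}"
      (is "_ \<subseteq> _ - ?S")
    proof (intro Diff_mono order_refl subsetI)
      fix x assume "x \<in> ?S"
      then obtain i where "i \<in> pts N" "snd i < r0" "x \<in> cball (fst i) (\<kappa> * (real m * \<theta> (snd i)))"
        using zero_less_one by blast
      then show "x \<in> slabs N"
        using in_slabs[of "fst i" "snd i" x] by simp
    qed
  qed
  then have "negligible (\<Union>N. box 0 One - slabs N)"
    by (intro negligible_countable_Union) auto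
  \<comment> \<open>The boundary of the cube, missing from the open box, is null.\<close>
  then have "negligible ((\<Union>N. box 0 One - slabs N) \<union> (cbox 0 One - box 0 One))"
    using negligible_frontier_interval by (rule negligible_Un)
  then have neg: "negligible (unit_cube - approximable_set y \<Phi> \<Psi>)"
    by (rule negligible_subset) (use slabs_approximable in blast)
  have "hausdorff_measure f (approximable_set y \<Phi> \<Psi> \<union> (unit_cube - approximable_set y \<Phi> \<Psi>))
      = hausdorff_measure f (approximable_set y \<Phi> \<Psi>)"
  proof (rule hausdorff_measure_Un_null[of f, OF f0(1)])
    show "hausdorff_pre f \<rho> (unit_cube - approximable_set y \<Phi> \<Psi>) = 0" if "\<rho> > 0" for \<rho>
      by (rule hausdorff_pre_negligible[where f = f, OF neg that f0(1) bdd[unfolded dim]])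
  qed
  moreover have "approximable_set y \<Phi> \<Psi> \<union> (unit_cube - approximable_set y \<Phi> \<Psi>) = (unit_cube :: (real^'m^'n) set)"
    by (auto simp: approximable_set_def)
  ultimately show ?thesis by simp
qed

end

section \<open>Reduction of the theorem to the two regimes\<close>

theorem theorem6:
  fixes \<Psi> \<Theta> :: "(int^'m) \<times> (int^'n) \<Rightarrow> real"
    and y :: "real^'m" and \<Phi> :: "real^'m^'m"
    and f g :: "real \<Rightarrow> real"
  assumes "\<And>p q. (p, q) \<noteq> 0 \<Longrightarrow> 0 \<le> \<Psi> (p, q)"
    and "((\<lambda>q. SUP p. ennreal (\<Psi> (p, q) / height q)) \<longlongrightarrow> 0) height_at_top"
    and "y \<in> unit_cube"
    and "\<Phi> \<in> unit_cube - {0}"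
    and "g = (\<lambda>r. r powr (- (real CARD('m) * (real CARD('n) - 1))) * f r)"
    and "dimension_function f"
    and "dimension_function g"
    and "mono_on {0<..} (\<lambda>r. r powr (- (real CARD('n) * real CARD('m))) * f r) \<or>
         antimono_on {0<..} (\<lambda>r. r powr (- (real CARD('n) * real CARD('m))) * f r)"
    and "\<Theta> = (\<lambda>(p, q). height q * g (\<Psi> (p, q) / height q) powr (1 / real CARD('m)))"
    and "emeasure lebesgue (approximable_set y \<Phi> \<Theta>) = 1"
  shows "hausdorff_measure f (approximable_set y \<Phi> \<Psi>) =
         hausdorff_measure f (unit_cube :: (real^'m^'n) set)"
proof -
  define m n l where "m = CARD('m)" and "n = CARD('n)" and "l = (n - 1) * m"
  define \<theta> where "\<theta> r = g r powr (1 / real m)" for r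
  have mn: "0 < m" "0 < n" by (simp_all add: m_def n_def)
  have lm: "l + m = n * m"
    using mn by (cases n) (auto simp: l_def)
  \<comment> \<open>As \<open>n\<close> is positive, the truncated subtraction in \<open>l\<close>
    agrees with the real one in the exponent.\<close>
  have exps: "real CARD('m) * (real CARD('n) - 1) = real l" "real CARD('n) * real CARD('m) = real (l + m)"
    using mn by (simp_all only: lm) (simp_all add: l_def m_def n_def of_nat_diff)
  have g: "g r = f r / r ^ l" if "0 < r" for r
    using that unfolding assms(5) exps by (simp add: powr_minus powr_realpow field_simps)
  have h: "r powr (- (real CARD('n) * real CARD('m))) * f r = f r / r ^ (l + m)" if "0 < r" for r
    using that unfolding exps by (simp add: powr_minus powr_realpow field_simps del: of_nat_add)
  have f_nonneg: "0 \<le> f r" if "0 \<le> r" for r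
    using assms(6) that by (simp add: dimension_function_def)
  have f_mono: "f r \<le> f s" if "0 \<le> r" "r \<le> s" for r s
    using assms(6) that by (auto simp: dimension_function_def mono_on_def)
  have f_lim: "(f \<longlongrightarrow> 0) (at_right 0)" and g_lim: "(g \<longlongrightarrow> 0) (at_right 0)"
    using assms(6,7) by (auto simp: dimension_function_def)
  have f00: "f 0 = 0"
  proof (rule antisym)
    have "eventually (\<lambda>r. f 0 \<le> f r) (at_right 0)"
      using eventually_at_right_less[of 0] by eventually_elim (simp add: f_mono)
    then show "f 0 \<le> 0"
      using f_lim by (intro tendsto_lowerbound) auto
  qed (simp add: f_nonneg)
  have g_nonneg: "0 \<le> g r" if "0 \<le> r" for r
    using assms(7) that by (simp add: dimension_function_def)
  interpret linear_forms \<Psi> y \<Phi> f \<theta> l m n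
  proof
    \<comment> \<open>The supremum over \<open>p\<close> stands inside the limit, so one
      \<open>N\<close> serves all \<open>p\<close>.\<close>
    show "\<exists>N. \<forall>p q. N \<le> height q \<longrightarrow> \<Psi> (p, q) / height q < \<epsilon>" if e: "\<epsilon> > 0" for \<epsilon>
    proof -
      have "eventually (\<lambda>q. (SUP p. ennreal (\<Psi> (p, q) / height q)) < ennreal \<epsilon>) height_at_top"
        using assms(2) e by (intro order_tendstoD(2)) auto
      then obtain P where P: "eventually P at_top"
          "\<And>q. P (height q) \<Longrightarrow> (SUP p. ennreal (\<Psi> (p, q) / height q)) < ennreal \<epsilon>"
        unfolding height_at_top_def eventually_filtercomap by blast
      from P(1) obtain N where N: "\<And>t. N \<le> t \<Longrightarrow> P t"
        by (auto simp: eventually_at_top_linorder)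
      have "\<Psi> (p, q) / height q < \<epsilon>" if "N \<le> height q" for p q
      proof -
        have "ennreal (\<Psi> (p, q) / height q) \<le> (SUP p. ennreal (\<Psi> (p, q) / height q))"
          by (rule SUP_upper) simp
        also have "\<dots> < ennreal \<epsilon>" using P(2) N that by blast
        finally show ?thesis by (metis ennreal_leI not_le)
      qed
      then show ?thesis by blast
    qed
    show "f r / r ^ l \<le> f s / s ^ l" if "0 < r" "r \<le> s" for r s
    proof -
      have "g r \<le> g s"
        using assms(7) that by (auto simp: dimension_function_def intro: mono_onD)
      then show ?thesis using g[of r] g[of s] that by simp
    qed
    show "((\<lambda>r. f r / r ^ l) \<longlongrightarrow> 0) (at_right 0)"
    proof (rule Lim_transform_eventually[OF g_lim])
      show "\<forall>\<^sub>F r in at_right 0. g r = f r / r ^ l"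
        using eventually_at_right_less[of 0] by eventually_elim (simp add: g)
    qed
    \<comment> \<open>\<open>0 powr a\<close> is 0 for every \<open>a\<close>, so
      \<open>g 0 = 0\<close> and then \<open>\<theta> 0 = 0\<close>.\<close>
    show "\<theta> 0 = 0" by (simp add: \<theta>_def assms(5))
    show "\<theta> r ^ m * r ^ l = f r" if r: "0 < r" for r
    proof -
      have "\<theta> r ^ m = g r"
      proof (cases "g r = 0")
        case False
        then have "0 < g r" using g_nonneg[of r] r by simp
        then show ?thesis
          using mn by (simp add: \<theta>_def powr_realpow[symmetric] powr_powr)
      qed (use mn in \<open>simp add: \<theta>_def\<close>)
      then show ?thesis using g[OF r] r by simp
    qed
    show "negligible (unit_cube - approximable_set y \<Phi> (\<lambda>(p, q). height q * \<theta> (\<Psi> (p, q) / height q)))"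
    proof -
      let ?A = "approximable_set y \<Phi> \<Theta> :: (real^'m^'n) set"
      \<comment> \<open>\<open>emeasure\<close> is 0 on nonmeasurable sets, so the value 1 already
        implies measurability.\<close>
      have A: "?A \<in> sets lebesgue"
        using assms(10) emeasure_notin_sets[of ?A lebesgue] by fastforce
      have sub: "?A \<subseteq> unit_cube" by (auto simp: approximable_set_def)
      have "emeasure lebesgue (unit_cube - ?A) = emeasure lebesgue (unit_cube :: (real^'m^'n) set) - emeasure lebesgue ?A"
        using A sub assms(10) by (intro emeasure_Diff) auto
      also have "emeasure lebesgue (unit_cube :: (real^'m^'n) set) = 1"
        by simp
      finally have "unit_cube - ?A \<in> null_sets lebesgue"
        using A assms(10) by (auto simp: null_sets_def)
      then show ?thesis
        by (simp add: negligible_iff_null_sets assms(9) \<theta>_def m_def)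
    qed
  qed (use assms(1) f_nonneg f_mono f_lim f00 in \<open>auto simp: m_def n_def l_def \<theta>_def\<close>)
  show ?thesis
  proof (cases "\<exists>r0>0. \<exists>K. \<forall>r. 0 < r \<and> r \<le> r0 \<longrightarrow> f r \<le> K * r ^ (l + m)")
    case True
    then show ?thesis using hausdorff_measure_bounded by blast
  next
    case False
    \<comment> \<open>A non-decreasing ratio would be bounded by \<open>f 1\<close> for
      \<open>0 < r \<le> 1\<close>, so only the antitone alternative remains.\<close>
    have "\<not> mono_on {0<..} (\<lambda>r. r powr (- (real CARD('n) * real CARD('m))) * f r)"
    proof
      assume mono: "mono_on {0<..} (\<lambda>r. r powr (- (real CARD('n) * real CARD('m))) * f r)"
      have "f r \<le> f 1 * r ^ (l + m)" if "0 < r" "r \<le> 1" for r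
        using mono_onD[OF mono, of r 1] h[of r] h[of 1] that by (simp add: pos_divide_le_eq)
      then show False using False zero_less_one by blast
    qed
    then have anti: "antimono_on {0<..} (\<lambda>r. r powr (- (real CARD('n) * real CARD('m))) * f r)"
      using assms(8) by blast
    have "hausdorff_measure f (approximable_set y \<Phi> \<Psi>) = top"
    proof (rule hausdorff_measure_unbounded)
      show "f s / s ^ (l + m) \<le> f r / r ^ (l + m)" if "0 < r" "r \<le> s" for r s
        using monotone_onD[OF anti, of r s] h[of r] h[of s] that by simp
      show "\<exists>r>0. B \<le> f r / r ^ (l + m)" for B
      proof (rule ccontr)
        assume no: "\<not> (\<exists>r>0. B \<le> f r / r ^ (l + m))"
        have "f r \<le> B * r ^ (l + m)" if "0 < r" for r
        proof -
          have "f r / r ^ (l + m) \<le> B" using no that by (meson linear)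
          then show ?thesis using that by (simp add: pos_divide_le_eq)
        qed
        then show False using False zero_less_one by blast
      qed
    qed
    \<comment> \<open>The cube contains a set of infinite measure, so both sides are
      \<open>top\<close>.\<close>
    moreover have "approximable_set y \<Phi> \<Psi> \<subseteq> (unit_cube :: (real^'m^'n) set)"
      by (auto simp: approximable_set_def)
    ultimately show ?thesis
      using hausdorff_measure_mono[of _ _ f] by (metis top.extremum_uniqueI)
  qed
qed

end
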